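(* Let $\boldsymbol{\mathcal F}(\cdot,\cdot)$ be either the LLF or the HLL numerical flux (see context) for the system $\partial_t\Phi+\partial_x\boldsymbol f(\Phi)=\boldsymbol 0$, $f_i(\Phi)=\phi_iv_i(\Phi)$, whose velocity functions admit a function $w$ with the properties (W1)--(W5) of the context. Consider the finite volume scheme $$\Phi_j^{n+1}=\Phi_j^n-\lambda_n\Bigl(\boldsymbol{\mathcal F}\bigl(\Phi_{j+1/2}^{\mathrm L},\Phi_{j+1/2}^{\mathrm R}\bigr)-\boldsymbol{\mathcal F}\bigl(\Phi_{j-1/2}^{\mathrm L},\Phi_{j-1/2}^{\mathrm R}\bigr)\Bigr)$$ with $$\Phi_{j-1/2}^{\mathrm R}=\boldsymbol{\bar P}_j(x_{j-1/2}),\qquad \Phi_{j+1/2}^{\mathrm L}=\boldsymbol{\bar P}_j(x_{j+1/2}),$$ where $\boldsymbol{\bar P}_j=(\bar P_j^{(1)},\dots,\bar P_j^{(N)})^{\mathrm T}$ are the limited WENO reconstruction polynomials defined in the context, with the quantities entering the limiters given by $$m_j^{(i)}=\min_{x\in S_j}P_j^{(i)}(x),\quad i=1,\dots,N,\qquad M_j=\max_{x\in S_j}\Bigl(\sum_{i=1}^N\tilde P_j^{(i)}(x)\Bigr),$$ $S_j$ being the set of Legendre--Gauss--Lobatto quadrature points on $I_j$. Let $\mu=1$ for the LLF flux and $\mu=1/2$ for the HLL flux. If the CFL condition $$\alpha\lambda_n\le\mu\,\hat w_1,\qquad \alpha:=\max_j\bigl\{|S_{\mathrm L,j+1/2}|,|S_{\mathrm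 R,j+1/2}|\bigr\},$$ is in effect, where $\hat w_1$ is the first (endpoint) weight of the quadrature rule, and $\Phi_j^n\in\mathcal D_{\phi_{\max}}$ for all $j$, then $\Phi_j^{n+1}\in\mathcal D_{\phi_{\max}}$ for all $j$.
   Context: Model. For $\Phi=(\phi_1,\dots,\phi_N)^{\mathrm T}$ write $\phi:=\phi_1+\dots+\phi_N$; $\phi_{\max}>0$ is a given maximum value and $$\mathcal D_{\phi_{\max}}:=\{\Phi\in\mathbb R^N:\ \phi_1\ge0,\dots,\phi_N\ge0,\ \phi\le\phi_{\max}\}.$$ The system is posed on $x\in[0,L]$, $t>0$, with $\boldsymbol f=(f_1,\dots,f_N)^{\mathrm T}$, and is assumed hyperbolic on $\mathcal D_{\phi_{\max}}$; $\lambda_1(\Phi)\ge\dots\ge\lambda_N(\Phi)$ are the eigenvalues of the Jacobian matrix of $\boldsymbol f$ at $\Phi$. Properties of $w$: (W1) $w=w(\phi)$ is piecewise differentiable and $\sum_{i=1}^N\phi_iv_i(\Phi)=w(\phi)\,\boldsymbol\kappa^{\mathrm T}\Phi$, where $\boldsymbol\kappa=(\kappa_1,\dots,\kappa_N)^{\mathrm T}$ with parameters $\kappa_1\ge\dots\ge\kappa_N>0$. (W2) $w(\phi)\ge0$ for all $\phi\in[0,\phi_{\max}]$. (W3) $w(\phi_{\max})=0$. (W4) $w'$ is nondecreasing, i.e. $w'(\phi)\le w'(\tilde\phi)$ if $0\le\phi\le\tilde\phi\le\phi_{\max}$. (W5) There exists a piecewise continuous function $\psi(\phi)$ such that $\psi(\phi)\,\boldsymbol\kappa^{\mathrm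 T}\Phi\le\lambda_N(\Phi)$ and $w'(\phi)\ge\psi(\phi)$ for all $\Phi\in\mathcal D_{\phi_{\max}}$. Numerical fluxes. For two states $U,V$ put $S_{\mathrm L}(U,V)=\min_{0\le s\le1}\tilde M_1(sV+(1-s)U)$ and $S_{\mathrm R}(U,V)=\max_{0\le s\le1}M_2(sV+(1-s)U)$, where $\tilde M_1(\Phi)=\psi(\phi)\boldsymbol\kappa^{\mathrm T}\Phi$ and $M_2$ is the upper eigenvalue bound belonging to the model under study. With $a^-=\min(a,0)$, $a^+=\max(a,0)$ and $S_{\mathrm L},S_{\mathrm R}$ evaluated at $(U,V)$: LLF (local Lax--Friedrichs): $\boldsymbol{\mathcal F}(U,V)=\frac12\bigl(\boldsymbol f(U)+\boldsymbol f(V)-\max\{|S_{\mathrm L}|,|S_{\mathrm R}|\}(V-U)\bigr)$; HLL (Harten--Lax--van Leer): $\boldsymbol{\mathcal F}(U,V)=\dfrac{S_{\mathrm R}^+\boldsymbol f(U)-S_{\mathrm L}^-\boldsymbol f(V)+S_{\mathrm L}^-S_{\mathrm R}^+(V-U)}{S_{\mathrm R}^+-S_{\mathrm L}^-}$. In the scheme, $S_{\mathrm L,j+1/2}$ and $S_{\mathrm R,j+1/2}$ are these bounds at the interface $x_{j+1/2}$, i.e. for the pair $(\Phi^{\mathrm L}_{j+1/2},\Phi^{\mathrm R}_{j+1/2})$. The bound $M_2$ is specified for two models (for both of which $S_{\mathrm L}^-<S_{\mathrm R}^+$, so that the HLL flux is well defined): - Multiclass Lighthill--Whitham--Richards (MCLWR)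 traffic model: $v_i=\beta_iv(\phi)$, $\beta_1>\dots>\beta_N>0$, $v>0$ on $[0,\phi_{\max})$, $v(\phi_{\max})=0$, $v'\le0$, $v'$ nondecreasing; here $M_2(\Phi)=\beta_1v(\phi)$, $w=v$, $\boldsymbol\kappa=(\beta_1,\dots,\beta_N)^{\mathrm T}$, $\psi=v'$. - Masliyah--Lockett--Bassoon (MLB) polydisperse sedimentation model: $v_i(\Phi)=C(1-\phi)V(\phi)(\delta_i-\boldsymbol\delta^{\mathrm T}\Phi)$, $\boldsymbol\delta=(\delta_1,\dots,\delta_N)^{\mathrm T}$, $\delta_i=D_i^2/D_1^2$ with particle diameters $D_1>\dots>D_N$, $C$ a constant (proportional to the solid--fluid density difference), $V>0$ on $[0,\phi_{\max})$, $V(\phi_{\max})=0$, $V'\le0$; here $M_2(\Phi)=v_1(\Phi)$, $w(\phi)=C(1-\phi)^2V(\phi)$, $\boldsymbol\kappa=\boldsymbol\delta$, $\psi(\phi)=C[(1-\phi)V'(\phi)-2V(\phi)]$. Grid. Cells $I_j=[x_{j-1/2},x_{j+1/2}]$, $j=0,\dots,M-1$, of width $\Delta x=L/M$; $\lambda_n=\Delta t_n/\Delta x$ with time steps $\Delta t_n$; $\Phi_j^n=(\phi_{1,j}^n,\dots,\phi_{N,j}^n)^{\mathrm T}$ are the approximate cell averages at time level $n$, and $\phi_j^n:=\phi_{1,j}^n+\dots+\phi_{N,j}^n$. Boundary conditions are periodic (fluxes at interfaces $-1/2$ and $M-1/2$ coincide) or zero-flux (these two fluxes are set to $\boldsymbol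 0$). WENO reconstruction (applied to each component $i$ separately, with $\bar u_l:=\phi_{i,l}^n$). Fix $r\in\{1,2\}$ (order $2r+1$). Let $P_{\mathrm{opt}}$ be the polynomial of degree $\le2r$ whose averages over $I_{j+\ell}$ are $\bar u_{j+\ell}$, $\ell=-r,\dots,r$, and, for $k=1,\dots,r+1$, let $P_k$ be the polynomial of degree $\le r$ whose averages over $I_{j-r+k+\ell-1}$ are $\bar u_{j-r+k+\ell-1}$, $\ell=0,\dots,r$. With linear weights $C_0,\dots,C_{r+1}\in[0,1]$, $\sum_kC_k=1$, $C_0>0$, put $P_0=\frac1{C_0}\bigl(P_{\mathrm{opt}}-\sum_{k=1}^{r+1}C_kP_k\bigr)$, $\alpha_k=C_k/(IS_k+\varepsilon)^p$ and $\omega_k=\alpha_k/(\alpha_0+\dots+\alpha_{r+1})$, $k=0,\dots,r+1$, where $\varepsilon>0$ is small, $p\ge2$, and $IS_k$ is a suitable regularity indicator, e.g. the Jiang--Shu indicator $IS_k=\sum_{\ell=1}^{\deg P_k}\Delta x^{2\ell-1}\int_{I_j}\bigl(\tfrac{\mathrm d^\ell P_k}{\mathrm dx^\ell}\bigr)^2\mathrm dx$. The reconstruction polynomial is $P_j^{(i)}=\sum_{k=0}^{r+1}\omega_kP_k$. Quadrature. $S_j=\{x_{j-1/2}=\hat x_j^1,\hat x_j^2,\dots,\hat x_j^G=x_{j+1/2}\}$ are the nodes of the $G$-point Legendre--Gauss--Lobatto rule on $I_j$, exact for polynomials of degree up to $2G-3$, with weights $\hat w_1,\dots,\hat w_G$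 normalized by $\sum_\alpha\hat w_\alpha=1$ (so $\hat w_1=\hat w_G$). One uses $G=3$ (weights $\frac16,\frac23,\frac16$) for the third-order and $G=4$ (weights $\frac1{12},\frac5{12},\frac5{12},\frac1{12}$) for the fifth-order reconstruction. Limiter (with $m_j^{(i)}$, $M_j$ as in the claim). $\tilde P_j^{(i)}(x)=\theta_i\bigl(P_j^{(i)}(x)-\phi_{i,j}^n\bigr)+\phi_{i,j}^n$ with $\theta_i=\min\bigl\{\frac{\phi_{i,j}^n-\delta}{\phi_{i,j}^n-m_j^{(i)}},1\bigr\}$, and $\bar P_j^{(i)}(x)=\hat\theta\bigl(\tilde P_j^{(i)}(x)-\phi_{i,j}^n\bigr)+\phi_{i,j}^n$ with $\hat\theta=\min\bigl\{\bigl|\frac{\phi_{\max}-\phi_j^n}{M_j-\phi_j^n}\bigr|,1\bigr\}$, $i=1,\dots,N$. Here $\delta>0$ is a small number (e.g. $10^{-12}$), the limiter being set up for data with $\phi_{i,j}^n\ge\delta$ for all $i$ and $\phi_j^n\le\phi_{\max}$. *)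

theory Defs
  imports "HOL-Analysis.Analysis" "HOL-Computational_Algebra.Polynomial"
begin

type_synonym 'n state = "(real, 'n) vec"

text \<open>The species are indexed by a finite linearly ordered type; species 1 is \<open>Min UNIV\<close>.\<close>

definition total_conc :: "('n::finite) state \<Rightarrow> real" where
  "total_conc \<Phi> = (\<Sum>i\<in>UNIV. \<Phi> $ i)"

definition state_set :: "real \<Rightarrow> ('n::finite) state set" where
  "state_set \<phi>max = {\<Phi>. (\<forall>i. 0 \<le> \<Phi> $ i) \<and> total_conc \<Phi> \<le> \<phi>max}"

definition phys_flux :: "(('n::finite) state \<Rightarrow> 'n state) \<Rightarrow> 'n state \<Rightarrow> 'n state" where
  "phys_flux v \<Phi> = (\<chi> i. \<Phi> $ i * v \<Phi> $ i)"

definition complex_eigenvalues :: "real ^ 'n ^ 'n \<Rightarrow> complex set" where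
  "complex_eigenvalues A =
     {z. \<exists>x :: complex ^ 'n. x \<noteq> 0 \<and> (\<chi> i j. complex_of_real (A $ i $ j)) *v x = z *s x}"

definition smallest_eigenvalue :: "real ^ 'n ^ 'n \<Rightarrow> real" where
  "smallest_eigenvalue A = Min {l. complex_of_real l \<in> complex_eigenvalues A}"

text \<open>Hyperbolicity means real eigenvalues, not diagonalizability: at boundary points of the state
  set (some concentration zero) the Jacobian of the models below can have nontrivial Jordan blocks.
  Since the velocities are only piecewise differentiable, a condition on the eigenvalues of the
  Jacobian is imposed at those states where the Jacobian exists.\<close>

definition hyperbolic_on :: "('n::finite) state set \<Rightarrow> ('n state \<Rightarrow> 'n state) \<Rightarrow> bool" where
  "hyperbolic_on D f \<longleftrightarrow>
     (\<forall>\<Phi>\<in>D. f differentiable (at \<Phi> within D) \<longrightarrow>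
        complex_eigenvalues (jacobian f (at \<Phi> within D)) \<subseteq> \<real>)"

text \<open>\<open>f'\<close> is the derivative wherever that exists. At the finitely many kinks \<open>f'\<close> has some value,
  which takes part in pointwise conditions such as monotonicity of \<open>f'\<close>.\<close>

definition has_pw_derivative_on :: "(real \<Rightarrow> real) \<Rightarrow> (real \<Rightarrow> real) \<Rightarrow> real set \<Rightarrow> bool" where
  "has_pw_derivative_on f f' S \<longleftrightarrow>
     f piecewise_differentiable_on S \<and>
     (\<forall>x\<in>S. f differentiable (at x within S) \<longrightarrow> (f has_real_derivative f' x) (at x within S))"

definition pw_continuous_on :: "real \<Rightarrow> real \<Rightarrow> (real \<Rightarrow> real) \<Rightarrow> bool" where
  "pw_continuous_on a b g \<longleftrightarrow>
     (\<exists>T. finite T \<and> T \<subseteq> {a..b} \<and>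
        (\<forall>x\<in>{a..b} - T. continuous (at x within {a..b}) g) \<and>
        (\<forall>x\<in>T. (\<exists>l. (g \<longlongrightarrow> l) (at x within {a..<x})) \<and> (\<exists>l. (g \<longlongrightarrow> l) (at x within {x<..b}))))"

definition w_properties ::
  "real \<Rightarrow> (('n::{finite,linorder}) state \<Rightarrow> 'n state) \<Rightarrow> 'n state \<Rightarrow>
   (real \<Rightarrow> real) \<Rightarrow> (real \<Rightarrow> real) \<Rightarrow> (real \<Rightarrow> real) \<Rightarrow> bool" where
  "w_properties \<phi>max v \<kappa> w w' \<psi> \<longleftrightarrow>
     (has_pw_derivative_on w w' {0..\<phi>max} \<and>
      (\<forall>i j. i \<le> j \<longrightarrow> \<kappa> $ j \<le> \<kappa> $ i) \<and> (\<forall>i. 0 < \<kappa> $ i) \<and>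
      (\<forall>\<Phi>\<in>state_set \<phi>max. (\<Sum>i\<in>UNIV. \<Phi> $ i * v \<Phi> $ i) = w (total_conc \<Phi>) * (\<kappa> \<bullet> \<Phi>))) \<and>
     (\<forall>x\<in>{0..\<phi>max}. 0 \<le> w x) \<and>
     w \<phi>max = 0 \<and>
     mono_on {0..\<phi>max} w' \<and>
     (pw_continuous_on 0 \<phi>max \<psi> \<and>
      (\<forall>\<Phi>\<in>state_set \<phi>max.
         (phys_flux v differentiable (at \<Phi> within state_set \<phi>max) \<longrightarrow>
            \<psi> (total_conc \<Phi>) * (\<kappa> \<bullet> \<Phi>)
              \<le> smallest_eigenvalue (jacobian (phys_flux v) (at \<Phi> within state_set \<phi>max))) \<and>
         \<psi> (total_conc \<Phi>) \<le> w' (total_conc \<Phi>)))"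

text \<open>Each predicate says that the velocities \<open>v\<close> are those of the model and that \<open>w\<close>, \<open>\<kappa>\<close>, \<open>\<psi>\<close>
  and the upper bound \<open>M2\<close> of the wave speeds are the ones belonging to it.\<close>

definition mclwr_model ::
  "real \<Rightarrow> (('n::{finite,linorder}) state \<Rightarrow> 'n state) \<Rightarrow> 'n state \<Rightarrow>
   (real \<Rightarrow> real) \<Rightarrow> (real \<Rightarrow> real) \<Rightarrow> ('n state \<Rightarrow> real) \<Rightarrow> bool" where
  "mclwr_model \<phi>max v \<kappa> w \<psi> M2 \<longleftrightarrow>
     (\<exists>(\<beta> :: 'n state) u u'.
        (\<forall>i j. i < j \<longrightarrow> \<beta> $ j < \<beta> $ i) \<and> (\<forall>i. 0 < \<beta> $ i) \<and>
        has_pw_derivative_on u u' {0..\<phi>max} \<and>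
        (\<forall>x\<in>{0..<\<phi>max}. 0 < u x) \<and> u \<phi>max = 0 \<and>
        (\<forall>x\<in>{0..\<phi>max}. u' x \<le> 0) \<and> mono_on {0..\<phi>max} u' \<and>
        (\<forall>\<Phi>\<in>state_set \<phi>max. v \<Phi> = u (total_conc \<Phi>) *\<^sub>R \<beta>) \<and>
        (\<forall>\<Phi>\<in>state_set \<phi>max. M2 \<Phi> = \<beta> $ Min UNIV * u (total_conc \<Phi>)) \<and>
        \<kappa> = \<beta> \<and>
        (\<forall>x\<in>{0..\<phi>max}. w x = u x \<and> \<psi> x = u' x))"

text \<open>No sign of the constant \<open>C\<close> is prescribed; \<open>C \<ge> 0\<close> follows from nonnegativity of \<open>w\<close>.\<close>

definition mlb_model ::
  "real \<Rightarrow> (('n::{finite,linorder}) state \<Rightarrow> 'n state) \<Rightarrow> 'n state \<Rightarrow>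
   (real \<Rightarrow> real) \<Rightarrow> (real \<Rightarrow> real) \<Rightarrow> ('n state \<Rightarrow> real) \<Rightarrow> bool" where
  "mlb_model \<phi>max v \<kappa> w \<psi> M2 \<longleftrightarrow>
     (\<exists>(d :: 'n state) (\<delta> :: 'n state) C V V'.
        (\<forall>i j. i < j \<longrightarrow> d $ j < d $ i) \<and> (\<forall>i. 0 < d $ i) \<and>
        \<delta> = (\<chi> i. (d $ i)\<^sup>2 / (d $ Min UNIV)\<^sup>2) \<and>
        has_pw_derivative_on V V' {0..\<phi>max} \<and>
        (\<forall>x\<in>{0..<\<phi>max}. 0 < V x) \<and> V \<phi>max = 0 \<and> (\<forall>x\<in>{0..\<phi>max}. V' x \<le> 0) \<and>
        (\<forall>\<Phi>\<in>state_set \<phi>max.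
           v \<Phi> = (\<chi> i. C * (1 - total_conc \<Phi>) * V (total_conc \<Phi>) * (\<delta> $ i - \<delta> \<bullet> \<Phi>))) \<and>
        (\<forall>\<Phi>\<in>state_set \<phi>max. M2 \<Phi> = v \<Phi> $ Min UNIV) \<and>
        \<kappa> = \<delta> \<and>
        (\<forall>x\<in>{0..\<phi>max}. w x = C * (1 - x)\<^sup>2 * V x \<and>
                            \<psi> x = C * ((1 - x) * V' x - 2 * V x)))"

text \<open>As \<open>\<psi>\<close> is only piecewise continuous, the minimum defining the lower speed need not be
  attained; it is read as an infimum. The maximum defining the upper speed is attained for the
  two models.\<close>

definition speed_L :: "(real \<Rightarrow> real) \<Rightarrow> ('n::finite) state \<Rightarrow> 'n state \<Rightarrow> 'n state \<Rightarrow> real" where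
  "speed_L \<psi> \<kappa> U V =
     (INF s\<in>{0..1}. let \<Phi> = s *\<^sub>R V + (1 - s) *\<^sub>R U in \<psi> (total_conc \<Phi>) * (\<kappa> \<bullet> \<Phi>))"

definition speed_R :: "(('n::finite) state \<Rightarrow> real) \<Rightarrow> 'n state \<Rightarrow> 'n state \<Rightarrow> real" where
  "speed_R M2 U V = (SUP s\<in>{0..1}. M2 (s *\<^sub>R V + (1 - s) *\<^sub>R U))"

definition llf_flux ::
  "(('n::finite) state \<Rightarrow> 'n state) \<Rightarrow> real \<Rightarrow> real \<Rightarrow> 'n state \<Rightarrow> 'n state \<Rightarrow> 'n state" where
  "llf_flux f SL SR U V = (1/2) *\<^sub>R (f U + f V - max \<bar>SL\<bar> \<bar>SR\<bar> *\<^sub>R (V - U))"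

text \<open>In the degenerate case \<open>min SL 0 = max SR 0\<close> the scalar factor is zero by the library
  convention for division, and so is the flux. For the two models this only occurs when \<open>f U\<close> and
  \<open>f V\<close> vanish.\<close>

definition hll_flux ::
  "(('n::finite) state \<Rightarrow> 'n state) \<Rightarrow> real \<Rightarrow> real \<Rightarrow> 'n state \<Rightarrow> 'n state \<Rightarrow> 'n state" where
  "hll_flux f SL SR U V =
     (let a = min SL 0; b = max SR 0
      in (1 / (b - a)) *\<^sub>R (b *\<^sub>R f U - a *\<^sub>R f V + (a * b) *\<^sub>R (V - U)))"

datatype flux_kind = LLF | HLL

definition num_flux ::
  "flux_kind \<Rightarrow> (('n::finite) state \<Rightarrow> 'n state) \<Rightarrow> (real \<Rightarrow> real) \<Rightarrow> 'n state \<Rightarrow> ('n state \<Rightarrow> real) \<Rightarrow>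
   'n state \<Rightarrow> 'n state \<Rightarrow> 'n state" where
  "num_flux kind f \<psi> \<kappa> M2 U V =
     (case kind of
        LLF \<Rightarrow> llf_flux f (speed_L \<psi> \<kappa> U V) (speed_R M2 U V) U V
      | HLL \<Rightarrow> hll_flux f (speed_L \<psi> \<kappa> U V) (speed_R M2 U V) U V)"

definition cfl_factor :: "flux_kind \<Rightarrow> real" where
  "cfl_factor kind = (case kind of LLF \<Rightarrow> 1 | HLL \<Rightarrow> 1/2)"

text \<open>The point \<open>edge \<Delta>x j\<close> is the left end of cell \<open>j\<close>, that is \<open>x\<close> with index \<open>j - 1/2\<close>. Cells and
  cell averages are indexed by all integers; cells outside \<open>{0..<M}\<close> are ghost cells.\<close>

definition edge :: "real \<Rightarrow> int \<Rightarrow> real" where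
  "edge \<Delta>x j = real_of_int j * \<Delta>x"

definition cell_average :: "real \<Rightarrow> int \<Rightarrow> real poly \<Rightarrow> real" where
  "cell_average \<Delta>x j P = integral {edge \<Delta>x j..edge \<Delta>x (j + 1)} (poly P) / \<Delta>x"

definition avg_interpolant :: "real \<Rightarrow> (int \<Rightarrow> real) \<Rightarrow> int \<Rightarrow> nat \<Rightarrow> real poly" where
  "avg_interpolant \<Delta>x u a n =
     (THE P. degree P \<le> n \<and> (\<forall>l\<in>{0..n}. cell_average \<Delta>x (a + int l) P = u (a + int l)))"

text \<open>The regularity indicator takes the index \<open>k\<close>, the cell and the polynomial \<open>P\<^sub>k\<close>.\<close>

record weno =
  half_width :: nat
  lin_weight :: "nat \<Rightarrow> real"
  weno_eps :: real
  weno_exp :: real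
  regularity :: "nat \<Rightarrow> int \<Rightarrow> real poly \<Rightarrow> real"

definition valid_weno :: "weno \<Rightarrow> bool" where
  "valid_weno W \<longleftrightarrow>
     half_width W \<in> {1, 2} \<and>
     (\<forall>k\<in>{0..half_width W + 1}. lin_weight W k \<in> {0..1}) \<and>
     (\<Sum>k=0..half_width W + 1. lin_weight W k) = 1 \<and> 0 < lin_weight W 0 \<and>
     0 < weno_eps W \<and> 2 \<le> weno_exp W \<and>
     (\<forall>k j P. 0 \<le> regularity W k j P)"

text \<open>The standard choice of the indicator; \<open>(pderiv ^^ l) P\<close> is the derivative of order \<open>l\<close>.\<close>

definition jiang_shu :: "real \<Rightarrow> nat \<Rightarrow> int \<Rightarrow> real poly \<Rightarrow> real" where
  "jiang_shu \<Delta>x k j P =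
     (\<Sum>l=1..degree P. \<Delta>x ^ (2 * l - 1) *
        integral {edge \<Delta>x j..edge \<Delta>x (j + 1)} (\<lambda>x. (poly ((pderiv ^^ l) P) x)\<^sup>2))"

lemma jiang_shu_nonneg: "0 \<le> \<Delta>x \<Longrightarrow> 0 \<le> jiang_shu \<Delta>x k j P"
  unfolding jiang_shu_def
  by (intro sum_nonneg mult_nonneg_nonneg Henstock_Kurzweil_Integration.integral_nonneg
        integrable_continuous_real continuous_intros) auto

definition weno_candidate :: "weno \<Rightarrow> real \<Rightarrow> (int \<Rightarrow> real) \<Rightarrow> int \<Rightarrow> nat \<Rightarrow> real poly" where
  "weno_candidate W \<Delta>x u j k =
     (let r = half_width W;
          Popt = avg_interpolant \<Delta>x u (j - int r) (2 * r);
          P = (\<lambda>k. avg_interpolant \<Delta>x u (j - int r + int k - 1) r)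
      in if k = 0
         then smult (1 / lin_weight W 0) (Popt - (\<Sum>l=1..r + 1. smult (lin_weight W l) (P l)))
         else P k)"

definition weno_alpha :: "weno \<Rightarrow> real \<Rightarrow> (int \<Rightarrow> real) \<Rightarrow> int \<Rightarrow> nat \<Rightarrow> real" where
  "weno_alpha W \<Delta>x u j k =
     lin_weight W k / (regularity W k j (weno_candidate W \<Delta>x u j k) + weno_eps W) powr weno_exp W"

definition weno_omega :: "weno \<Rightarrow> real \<Rightarrow> (int \<Rightarrow> real) \<Rightarrow> int \<Rightarrow> nat \<Rightarrow> real" where
  "weno_omega W \<Delta>x u j k =
     weno_alpha W \<Delta>x u j k / (\<Sum>l=0..half_width W + 1. weno_alpha W \<Delta>x u j l)"

definition weno_poly :: "weno \<Rightarrow> real \<Rightarrow> (int \<Rightarrow> real) \<Rightarrow> int \<Rightarrow> real poly" where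
  "weno_poly W \<Delta>x u j =
     (\<Sum>k=0..half_width W + 1. smult (weno_omega W \<Delta>x u j k) (weno_candidate W \<Delta>x u j k))"

text \<open>Nodes on the reference interval \<open>[-1, 1]\<close> and normalized weights for 3 and 4 points.\<close>

definition lgl_nodes :: "nat \<Rightarrow> real list" where
  "lgl_nodes G = (if G = 3 then [-1, 0, 1] else [-1, - (1 / sqrt 5), 1 / sqrt 5, 1])"

definition lgl_weights :: "nat \<Rightarrow> real list" where
  "lgl_weights G = (if G = 3 then [1/6, 2/3, 1/6] else [1/12, 5/12, 5/12, 1/12])"

definition lgl_points :: "real \<Rightarrow> nat \<Rightarrow> int \<Rightarrow> real set" where
  "lgl_points \<Delta>x G j = (\<lambda>\<xi>. edge \<Delta>x j + \<Delta>x / 2 * (1 + \<xi>)) ` set (lgl_nodes G)"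

lemma lgl_exact:
  assumes "G \<in> {3, 4}" "n \<le> 2 * G - 3"
  shows "integral {-1..1} (\<lambda>x::real. x ^ n) / 2
           = (\<Sum>m<G. lgl_weights G ! m * (lgl_nodes G ! m) ^ n)"
proof -
  have I: "integral {-1..1} (\<lambda>x::real. x ^ n) = (1 - (-1) ^ Suc n) / real (Suc n)"
  proof (rule integral_unique)
    have "((\<lambda>x::real. x ^ n) has_integral (1 ^ Suc n / real (Suc n) - (-1) ^ Suc n / real (Suc n))) {-1..1}"
      by (rule fundamental_theorem_of_calculus)
         (auto intro!: derivative_eq_intros simp flip: has_real_derivative_iff_has_vector_derivative
               simp del: of_nat_Suc power_Suc)
    then show "((\<lambda>x::real. x ^ n) has_integral ((1 - (-1) ^ Suc n) / real (Suc n))) {-1..1}"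
      by (simp only: power_one diff_divide_distrib)
  qed
  have s: "(sqrt 5) ^ 4 = (25::real)" "(sqrt 5)\<^sup>2 = (5::real)"
    by (simp_all add: power4_eq_xxxx)
  have "G = 3 \<and> n \<in> {0,1,2,3} \<or> G = 4 \<and> n \<in> {0,1,2,3,4,5}" using assms by auto
  then show ?thesis unfolding I
    by (elim disjE conjE insertE emptyE)
       (simp_all add: lgl_weights_def lgl_nodes_def lessThan_Suc eval_nat_numeral field_simps s)
qed

definition quad_size :: "weno \<Rightarrow> nat" where
  "quad_size W = (if half_width W = 1 then 3 else 4)"

definition endpoint_weight :: "weno \<Rightarrow> real" where
  "endpoint_weight W = hd (lgl_weights (quad_size W))"

text \<open>The quotients in the two limiter coefficients are read as infinite, i.e. no limiting takes
  place, if their denominators vanish. \<open>U j\<close> is the vector of cell averages of cell \<open>j\<close>.\<close>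

definition lower_limited ::
  "weno \<Rightarrow> real \<Rightarrow> real \<Rightarrow> (int \<Rightarrow> ('n::finite) state) \<Rightarrow> int \<Rightarrow> 'n \<Rightarrow> real poly" where
  "lower_limited W \<Delta>x \<delta> U j i =
     (let P = weno_poly W \<Delta>x (\<lambda>l. U l $ i) j;
          a = U j $ i;
          m = Min (poly P ` lgl_points \<Delta>x (quad_size W) j);
          \<theta> = (if a = m then 1 else min ((a - \<delta>) / (a - m)) 1)
      in smult \<theta> (P - [:a:]) + [:a:])"

definition limited ::
  "weno \<Rightarrow> real \<Rightarrow> real \<Rightarrow> real \<Rightarrow> (int \<Rightarrow> ('n::finite) state) \<Rightarrow> int \<Rightarrow> 'n \<Rightarrow> real poly" where
  "limited W \<Delta>x \<delta> \<phi>max U j i =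
     (let Mx = Max ((\<lambda>x. \<Sum>i\<in>UNIV. poly (lower_limited W \<Delta>x \<delta> U j i) x)
                      ` lgl_points \<Delta>x (quad_size W) j);
          a = U j $ i;
          \<theta> = (if Mx = total_conc (U j) then 1
               else min \<bar>(\<phi>max - total_conc (U j)) / (Mx - total_conc (U j))\<bar> 1)
      in smult \<theta> (lower_limited W \<Delta>x \<delta> U j i - [:a:]) + [:a:])"

datatype boundary = Periodic | Zero_Flux

text \<open>The states to the left and to the right of the interface \<open>j + 1/2\<close>. Reduction modulo the
  number \<open>M\<close> of cells identifies the interfaces \<open>-1/2\<close> and \<open>M - 1/2\<close>; it has no effect at the
  interior interfaces.\<close>

definition state_L ::
  "weno \<Rightarrow> real \<Rightarrow> real \<Rightarrow> real \<Rightarrow> nat \<Rightarrow> (int \<Rightarrow> ('n::finite) state) \<Rightarrow> int \<Rightarrow> 'n state" where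
  "state_L W \<Delta>x \<delta> \<phi>max M U j =
     (let k = j mod int M in \<chi> i. poly (limited W \<Delta>x \<delta> \<phi>max U k i) (edge \<Delta>x (k + 1)))"

definition state_R ::
  "weno \<Rightarrow> real \<Rightarrow> real \<Rightarrow> real \<Rightarrow> nat \<Rightarrow> (int \<Rightarrow> ('n::finite) state) \<Rightarrow> int \<Rightarrow> 'n state" where
  "state_R W \<Delta>x \<delta> \<phi>max M U j =
     (let k = (j + 1) mod int M in \<chi> i. poly (limited W \<Delta>x \<delta> \<phi>max U k i) (edge \<Delta>x k))"

text \<open>Zero-flux boundaries: the two outer interfaces carry the flux 0 and have no wave speeds, so
  they do not enter the CFL condition either.\<close>

definition interfaces :: "boundary \<Rightarrow> nat \<Rightarrow> int set" where
  "interfaces bc M = (case bc of Periodic \<Rightarrow> {-1..int M - 1} | Zero_Flux \<Rightarrow> {0..int M - 2})"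

definition interface_flux ::
  "boundary \<Rightarrow> nat \<Rightarrow> (('n::finite) state \<Rightarrow> 'n state \<Rightarrow> 'n state) \<Rightarrow>
   (int \<Rightarrow> 'n state) \<Rightarrow> (int \<Rightarrow> 'n state) \<Rightarrow> int \<Rightarrow> 'n state" where
  "interface_flux bc M F UL UR j = (if j \<in> interfaces bc M then F (UL j) (UR j) else 0)"

definition max_speed ::
  "boundary \<Rightarrow> nat \<Rightarrow> (real \<Rightarrow> real) \<Rightarrow> ('n::finite) state \<Rightarrow> ('n state \<Rightarrow> real) \<Rightarrow>
   (int \<Rightarrow> 'n state) \<Rightarrow> (int \<Rightarrow> 'n state) \<Rightarrow> real" where
  "max_speed bc M \<psi> \<kappa> M2 UL UR =
     Max (\<Union>j\<in>interfaces bc M. {\<bar>speed_L \<psi> \<kappa> (UL j) (UR j)\<bar>, \<bar>speed_R M2 (UL j) (UR j)\<bar>})"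

end

theory Submission
  imports Defs
begin

text \<open>By exactness of the quadrature rule a cell average is the convex combination of the values of
  the limited reconstruction at the nodes, and the limiter puts all of these into the state set. The
  two end nodes have weight \<open>c\<close>, so one explicit step leaves the inner nodes alone and replaces the
  end values \<open>X\<close>, \<open>Y\<close> by \<open>c X - \<lambda> F\<close> and \<open>c Y + \<lambda> F'\<close>. Both fluxes have the HLL form with speeds
  \<open>a \<le> 0 \<le> b\<close> (local Lax--Friedrichs is the case \<open>b = - a\<close>), for which these two vectors lie in \<open>c\<close> times
  the state set: nonnegativity uses that \<open>a\<close> and \<open>b\<close> bound all velocities, the bound on the total
  concentration uses the convexity of \<open>w\<close>.\<close>

subsection \<open>Interpolation of cell averages\<close>

text \<open>Newton's construction: a multiple of the nodal polynomial of the old points corrects the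
  value at the new point and leaves the old values alone.\<close>

lemma poly_interpolation_exists:
  fixes f :: "real \<Rightarrow> real"
  assumes "finite A"
  shows "\<exists>Q. degree Q \<le> card A - 1 \<and> (\<forall>x\<in>A. poly Q x = f x)"
  using assms
proof (induction A rule: finite_induct)
  case empty
  then show ?case by (auto intro: exI[of _ 0])
next
  case (insert a A)
  then obtain Q where Q: "degree Q \<le> card A - 1" "\<forall>x\<in>A. poly Q x = f x" by blast
  define R where "R = (\<Prod>x\<in>A. [:- x, 1:])"
  have "degree R \<le> card A"
    using degree_prod_sum_le[OF insert.hyps(1), of "\<lambda>x. [:- x, 1:]"] by (simp add: R_def)
  moreover have nz: "poly R a \<noteq> 0"
    using insert.hyps by (auto simp: R_def poly_prod)
  moreover have "poly R x = 0" if "x \<in> A" for x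
    using insert.hyps(1) that by (auto simp: R_def poly_prod intro!: bexI[of _ x])
  ultimately have "degree (Q + smult ((f a - poly Q a) / poly R a) R) \<le> card (insert a A) - 1 \<and>
      (\<forall>x\<in>insert a A. poly (Q + smult ((f a - poly Q a) / poly R a) R) x = f x)"
    using Q insert.hyps by (auto intro!: degree_add_le order.trans[OF degree_smult_le])
  then show ?case by blast
qed

text \<open>Term-by-term integration. Primitives turn questions about cell averages into questions
  about point values at cell edges.\<close>

lemma poly_antiderivative_exists:
  fixes P :: "real poly"
  shows "\<exists>Q. pderiv Q = P"
proof -
  have "pderiv (\<Sum>i\<le>degree P. monom (coeff P i / real (Suc i)) (Suc i)) = (\<Sum>i\<le>degree P. monom (coeff P i) i)"
    using higher_pderiv_sum[of 1 "\<lambda>i. monom (coeff P i / real (Suc i)) (Suc i)" "{..degree P}"]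
    by (simp add: pderiv_monom del: of_nat_Suc)
  also have "\<dots> = P" by (rule poly_as_sum_of_monoms)
  finally show ?thesis by blast
qed

lemma poly_integrable: "poly (P :: real poly) integrable_on {a..b}"
  by (intro integrable_continuous_real continuous_intros)

lemma integral_pderiv:
  fixes a b :: real
  assumes "a \<le> b"
  shows "integral {a..b} (poly (pderiv Q)) = poly Q b - poly Q a"
  by (rule integral_unique, rule fundamental_theorem_of_calculus[OF assms])
     (auto simp flip: has_real_derivative_iff_has_vector_derivative
        intro: has_field_derivative_at_within)

lemma cell_average_pderiv:
  assumes "0 < \<Delta>x"
  shows "cell_average \<Delta>x j (pderiv Q) = (poly Q (edge \<Delta>x (j + 1)) - poly Q (edge \<Delta>x j)) / \<Delta>x"
  unfolding cell_average_def using assms by (subst integral_pderiv) (auto simp: edge_def)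

lemma cell_average_add:
  "cell_average \<Delta>x j (P + Q) = cell_average \<Delta>x j P + cell_average \<Delta>x j Q"
proof -
  have "poly (P + Q) = (\<lambda>x. poly P x + poly Q x)" by (simp add: fun_eq_iff)
  then show ?thesis
    by (simp add: cell_average_def integral_add poly_integrable add_divide_distrib)
qed

lemma cell_average_smult: "cell_average \<Delta>x j (smult c P) = c * cell_average \<Delta>x j P"
proof -
  have "poly (smult c P) = (\<lambda>x. c * poly P x)" by (simp add: fun_eq_iff)
  then show ?thesis by (simp add: cell_average_def)
qed

lemma cell_average_diff:
  "cell_average \<Delta>x j (P - Q) = cell_average \<Delta>x j P - cell_average \<Delta>x j Q"
  using cell_average_add[of \<Delta>x j P "smult (- 1) Q"] by (simp only: cell_average_smult) simp

lemma cell_average_sum: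
  "cell_average \<Delta>x j (\<Sum>k\<in>A. P k) = (\<Sum>k\<in>A. cell_average \<Delta>x j (P k))"
proof -
  have "cell_average \<Delta>x j 0 = 0" using cell_average_smult[of \<Delta>x j 0 0] by simp
  then show ?thesis
    by (induction A rule: infinite_finite_induct) (simp_all add: cell_average_add)
qed

lemma cell_average_const: "0 < \<Delta>x \<Longrightarrow> cell_average \<Delta>x j [:c:] = c"
proof -
  have "poly [:c:] = (\<lambda>x. c)" by (simp add: fun_eq_iff)
  then show "0 < \<Delta>x \<Longrightarrow> ?thesis" by (simp add: cell_average_def edge_def algebra_simps)
qed

lemma inj_edge: "0 < \<Delta>x \<Longrightarrow> inj_on (\<lambda>l. edge \<Delta>x (a + int l)) A"
  by (auto simp: inj_on_def edge_def)

text \<open>A primitive of \<open>P - Q\<close> takes one and the same value at the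
  \<open>n + 2\<close> edges of the \<open>n + 1\<close> cells. Its degree is at most
  \<open>n + 1\<close>, so it is constant.\<close>

lemma poly_eq_of_cell_averages:
  assumes "0 < \<Delta>x" "degree P \<le> n" "degree Q \<le> n"
    and "\<forall>l\<in>{0..n}. cell_average \<Delta>x (a + int l) P = cell_average \<Delta>x (a + int l) Q"
  shows "P = Q"
proof -
  obtain R where R: "pderiv R = P - Q" using poly_antiderivative_exists by blast
  have dR: "degree R \<le> n + 1"
    using degree_diff_le[OF assms(2,3)] unfolding R[symmetric] degree_pderiv by linarith
  have eq: "poly R (edge \<Delta>x (a + int l)) = poly R (edge \<Delta>x a)" if "l \<le> n + 1" for l
    using that
  proof (induction l)
    case (Suc l)
    have "cell_average \<Delta>x (a + int l) (P - Q) = 0"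
      using assms(4) Suc.prems by (simp add: cell_average_diff)
    then have "poly R (edge \<Delta>x (a + int l + 1)) = poly R (edge \<Delta>x (a + int l))"
      unfolding R[symmetric] cell_average_pderiv[OF assms(1)] using assms(1) by simp
    then show ?case using Suc by (simp add: add_ac)
  qed simp
  have "R = [:poly R (edge \<Delta>x a):]"
  proof (rule poly_eqI_degree[where A = "(\<lambda>l. edge \<Delta>x (a + int l)) ` {0..n + 1}"])
    show "poly R x = poly [:poly R (edge \<Delta>x a):] x"
      if "x \<in> (\<lambda>l. edge \<Delta>x (a + int l)) ` {0..n + 1}" for x
      using that eq by auto
  qed (use dR card_image[OF inj_edge[OF assms(1)], of a "{0..n + 1}"] in auto)
  then have "pderiv R = pderiv [:poly R (edge \<Delta>x a):]" by (rule arg_cong)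
  then show ?thesis using R by (simp add: pderiv_pCons)
qed

text \<open>The interpolant is the derivative of the polynomial that interpolates the cumulated cell
  integrals at the edges.\<close>

lemma avg_interpolant_exists:
  assumes "0 < \<Delta>x"
  shows "\<exists>P. degree P \<le> n \<and> (\<forall>l\<in>{0..n}. cell_average \<Delta>x (a + int l) P = u (a + int l))"
proof -
  let ?e = "\<lambda>l. edge \<Delta>x (a + int l)"
  define S where "S l = (\<Sum>m<l. u (a + int m) * \<Delta>x)" for l
  \<comment> \<open>\<open>the_inv\<close> recovers the number of an edge from its position, since
    the interpolation lemma prescribes values as a function of the point.\<close>
  obtain Q where dQ: "degree Q \<le> card (?e ` {0..n + 1}) - 1"
    and Q: "\<forall>x\<in>?e ` {0..n + 1}. poly Q x = S (the_inv ?e x)"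
    using poly_interpolation_exists[of "?e ` {0..n + 1}" "\<lambda>x. S (the_inv ?e x)"] by blast
  have Qe: "poly Q (?e l) = S l" if "l \<le> n + 1" for l
    using Q that the_inv_f_f[OF inj_edge[OF assms, of a UNIV]] by auto
  have "cell_average \<Delta>x (a + int l) (pderiv Q) = u (a + int l)" if "l \<le> n" for l
    using Qe[of l] Qe[of "Suc l"] that assms
    by (simp add: cell_average_pderiv S_def add_ac)
  moreover have "degree (pderiv Q) \<le> n"
    using dQ card_image[OF inj_edge[OF assms], of a "{0..n + 1}"] by (simp add: degree_pderiv)
  ultimately show ?thesis by auto
qed

text \<open>Existence and uniqueness make the definite description meaningful, so its defining
  properties become available.\<close>

lemma avg_interpolant:
  assumes "0 < \<Delta>x"
  shows degree_avg_interpolant: "degree (avg_interpolant \<Delta>x u a n) \<le> n"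
    and cell_average_avg_interpolant:
      "\<lbrakk>a \<le> j; j \<le> a + int n\<rbrakk> \<Longrightarrow> cell_average \<Delta>x j (avg_interpolant \<Delta>x u a n) = u j"
proof -
  let ?R = "\<lambda>P. degree P \<le> n \<and> (\<forall>l\<in>{0..n}. cell_average \<Delta>x (a + int l) P = u (a + int l))"
  have "\<exists>!P. ?R P"
    using avg_interpolant_exists[OF assms, of n a u]
    by (rule ex_ex1I) (rule poly_eq_of_cell_averages[OF assms, of _ n _ a], auto)
  then have R: "?R (avg_interpolant \<Delta>x u a n)"
    unfolding avg_interpolant_def by (rule theI')
  then show "degree (avg_interpolant \<Delta>x u a n) \<le> n" by simp
  show "cell_average \<Delta>x j (avg_interpolant \<Delta>x u a n) = u j" if "a \<le> j" "j \<le> a + int n"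
    using R[THEN conjunct2, THEN bspec, of "nat (j - a)"] that by auto
qed

section \<open>WENO reconstruction: degrees and averages\<close>

text \<open>For \<open>1 \<le> k \<le> r + 1\<close>, with \<open>r\<close> the half width, the
  stencil of candidate \<open>k\<close> contains cell \<open>j\<close>. For \<open>k = 0\<close> the
  average is \<open>u j\<close> because the linear weights sum to 1: subtracting the others leaves
  the share \<open>lin_weight W 0\<close>, which the prefactor cancels.\<close>

lemma weno_candidate:
  assumes "0 < \<Delta>x" "valid_weno W" "k \<le> half_width W + 1"
  shows degree_weno_candidate: "degree (weno_candidate W \<Delta>x u j k) \<le> 2 * half_width W"
    and cell_average_weno_candidate: "cell_average \<Delta>x j (weno_candidate W \<Delta>x u j k) = u j"
proof -
  let ?r = "half_width W"
  let ?P = "\<lambda>k. avg_interpolant \<Delta>x u (j - int ?r + int k - 1) ?r"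
  let ?Q = "avg_interpolant \<Delta>x u (j - int ?r) (2 * ?r)"
  have avP: "cell_average \<Delta>x j (?P l) = u j" if "l \<in> {1..?r + 1}" for l
    using that by (intro cell_average_avg_interpolant assms(1)) auto
  have avQ: "cell_average \<Delta>x j ?Q = u j"
    by (intro cell_average_avg_interpolant assms(1)) auto
  have dP: "degree (?P l) \<le> 2 * ?r" for l
    using degree_avg_interpolant[OF assms(1), of u _ ?r] by (rule order.trans) simp
  have dQ: "degree ?Q \<le> 2 * ?r" by (rule degree_avg_interpolant[OF assms(1)])
  have "(\<Sum>l=0..?r + 1. lin_weight W l) = lin_weight W 0 + (\<Sum>l=1..?r + 1. lin_weight W l)"
    by (simp add: sum.atLeast_Suc_atMost)
  then have C: "(\<Sum>l=1..?r + 1. lin_weight W l) = 1 - lin_weight W 0" and C0: "0 < lin_weight W 0"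
    using assms(2) unfolding valid_weno_def by linarith+
  have "(\<Sum>l=1..?r + 1. lin_weight W l * cell_average \<Delta>x j (?P l)) = (1 - lin_weight W 0) * u j"
    unfolding C[symmetric] sum_distrib_right by (rule sum.cong) (auto simp: avP)
  then have "cell_average \<Delta>x j (weno_candidate W \<Delta>x u j 0) = u j"
    using C0 avQ unfolding weno_candidate_def Let_def
    by (simp add: cell_average_smult cell_average_diff cell_average_sum field_simps
        del: sum.cl_ivl_Suc)
  moreover have "degree (weno_candidate W \<Delta>x u j 0) \<le> 2 * ?r"
    unfolding weno_candidate_def Let_def
    by (auto intro!: order.trans[OF degree_smult_le] degree_diff_le degree_sum_le dP dQ
        simp del: sum.cl_ivl_Suc)
  ultimately show "degree (weno_candidate W \<Delta>x u j k) \<le> 2 * ?r"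
    "cell_average \<Delta>x j (weno_candidate W \<Delta>x u j k) = u j"
    using dP avP assms(3) by (auto simp: weno_candidate_def[of _ _ _ _ k] Let_def) 
      (auto simp: weno_candidate_def Let_def)
qed

text \<open>The normalizing sum is positive: all its terms are nonnegative, and the one for
  \<open>k = 0\<close> is positive because its linear weight is.\<close>

lemma sum_weno_omega:
  assumes "valid_weno W"
  shows "(\<Sum>k=0..half_width W + 1. weno_omega W \<Delta>x u j k) = 1"
proof -
  \<comment> \<open>A positive base keeps the power in the denominator of \<open>weno_alpha\<close>
    positive.\<close>
  have pos: "0 < regularity W k j P + weno_eps W" for k P
    using assms by (auto simp: valid_weno_def intro!: add_nonneg_pos)
  have "0 \<le> weno_alpha W \<Delta>x u j k" if "k \<in> {0..half_width W + 1}" for k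
    using assms that by (auto simp: valid_weno_def weno_alpha_def)
  moreover have "0 < weno_alpha W \<Delta>x u j 0"
    using assms pos[of 0 "weno_candidate W \<Delta>x u j 0"] by (simp add: valid_weno_def weno_alpha_def)
  ultimately have "0 < (\<Sum>k=0..half_width W + 1. weno_alpha W \<Delta>x u j k)"
    by (intro sum_pos2[of _ 0]) auto
  then show ?thesis
    unfolding weno_omega_def sum_divide_distrib[symmetric] by simp
qed

text \<open>Nonlinear weights that sum to 1 preserve the common average of the candidates, however
  they depend on the data.\<close>

lemma weno_poly:
  assumes "0 < \<Delta>x" "valid_weno W"
  shows degree_weno_poly: "degree (weno_poly W \<Delta>x u j) \<le> 2 * half_width W"
    and cell_average_weno_poly: "cell_average \<Delta>x j (weno_poly W \<Delta>x u j) = u j"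
proof -
  show "degree (weno_poly W \<Delta>x u j) \<le> 2 * half_width W"
    unfolding weno_poly_def
    by (intro degree_sum_le order.trans[OF degree_smult_le] degree_weno_candidate assms) auto
  have "cell_average \<Delta>x j (weno_poly W \<Delta>x u j) = (\<Sum>k=0..half_width W + 1. weno_omega W \<Delta>x u j k * u j)"
    unfolding weno_poly_def cell_average_sum cell_average_smult
    by (rule sum.cong) (simp_all add: cell_average_weno_candidate assms)
  then show "cell_average \<Delta>x j (weno_poly W \<Delta>x u j) = u j"
    by (simp only: sum_distrib_right[symmetric] sum_weno_omega[OF assms(2)] mult_1)
qed

subsection \<open>Quadrature\<close>

text \<open>The set \<open>lgl_points\<close> forgets the order of the nodes; numbering them pairs
  each node with its weight.\<close>

definition lgl_point :: "real \<Rightarrow> nat \<Rightarrow> int \<Rightarrow> nat \<Rightarrow> real" where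
  "lgl_point \<Delta>x G j m = edge \<Delta>x j + \<Delta>x / 2 * (1 + lgl_nodes G ! m)"

lemma lgl_points_eq:
  assumes "G \<in> {3, 4}"
  shows "lgl_points \<Delta>x G j = lgl_point \<Delta>x G j ` {..<G}"
proof -
  have "length (lgl_nodes G) = G" using assms by (auto simp: lgl_nodes_def)
  then have "set (lgl_nodes G) = (!) (lgl_nodes G) ` {..<G}"
    by (auto simp: set_conv_nth)
  then show ?thesis by (simp add: lgl_points_def lgl_point_def image_image)
qed

text \<open>The polynomial \<open>q\<close> is \<open>P\<close> pulled back to the reference
  interval by the affine map of the cell. Substitution in the integral reduces the claim to
  exactness for monomials there.\<close>

lemma lgl_quadrature:
  assumes "0 < \<Delta>x" "G \<in> {3, 4}" "degree P \<le> 2 * G - 3"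
  shows "cell_average \<Delta>x j P = (\<Sum>m<G. lgl_weights G ! m * poly P (lgl_point \<Delta>x G j m))"
proof -
  define q where "q = pcompose P [:edge \<Delta>x j + \<Delta>x / 2, \<Delta>x / 2:]"
  have q: "poly q y = poly P (edge \<Delta>x j + \<Delta>x / 2 * (1 + y))" for y
    by (simp add: q_def poly_pcompose algebra_simps add_divide_distrib)
  have dq: "degree q \<le> 2 * G - 3" 
    using degree_pcompose_le[of P "[:edge \<Delta>x j + \<Delta>x / 2, \<Delta>x / 2:]"] assms(1,3) by (simp add: q_def)
  have "0 \<le> \<Delta>x / 2 * (1 + y)" "\<Delta>x / 2 * (1 + y) \<le> \<Delta>x / 2 * 2" if "y \<in> {- 1..1}" for y
    using that assms(1) by (intro mult_nonneg_nonneg mult_left_mono; simp)+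
  then have sub: "(\<lambda>y. edge \<Delta>x j + \<Delta>x / 2 * (1 + y)) ` {- 1..1} \<subseteq> {edge \<Delta>x j..edge \<Delta>x (j + 1)}"
    by (fastforce simp: edge_def algebra_simps)
  have "((\<lambda>y. (\<Delta>x / 2) *\<^sub>R poly P (edge \<Delta>x j + \<Delta>x / 2 * (1 + y))) has_integral
      integral {edge \<Delta>x j + \<Delta>x / 2 * (1 + - 1)..edge \<Delta>x j + \<Delta>x / 2 * (1 + 1)} (poly P)) {- 1..1}"
    using assms(1)
    by (intro has_integral_substitution[where c = "edge \<Delta>x j" and d = "edge \<Delta>x (j + 1)"])
       (use sub in \<open>auto intro!: continuous_intros derivative_eq_intros\<close>)
  then have "integral {- 1..1} (\<lambda>y. \<Delta>x / 2 * poly q y) = integral {edge \<Delta>x j..edge \<Delta>x (j + 1)} (poly P)"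
    by (simp add: q edge_def algebra_simps has_integral_iff)
  then have "cell_average \<Delta>x j P = integral {- 1..1} (poly q) / 2"
    using assms(1) by (simp add: cell_average_def field_simps)
  also have "integral {- 1..1} (poly q) = (\<Sum>n\<le>degree q. coeff q n * integral {- 1..1} (\<lambda>y. y ^ n))"
    unfolding poly_altdef[abs_def]
    by (subst integral_sum) (auto intro!: integrable_continuous_real continuous_intros)
  also have "\<dots> / 2 = (\<Sum>n\<le>degree q. coeff q n * (integral {- 1..1} (\<lambda>y. y ^ n) / 2))"
    by (simp add: sum_divide_distrib)
  also have "\<dots> = (\<Sum>n\<le>degree q. coeff q n * (\<Sum>m<G. lgl_weights G ! m * (lgl_nodes G ! m) ^ n))"
    using dq by (intro sum.cong refl arg_cong2[where f = "(*)"] lgl_exact assms(2)) auto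
  also have "\<dots> = (\<Sum>m<G. \<Sum>n\<le>degree q. coeff q n * (lgl_weights G ! m * (lgl_nodes G ! m) ^ n))"
    unfolding sum_distrib_left by (rule sum.swap)
  also have "\<dots> = (\<Sum>m<G. lgl_weights G ! m * poly q (lgl_nodes G ! m))"
    unfolding poly_altdef sum_distrib_left by (simp add: mult_ac)
  finally show ?thesis by (simp add: q lgl_point_def)
qed

lemma lgl_weights:
  assumes "G \<in> {3, 4}"
  shows lgl_weights_pos: "m < G \<Longrightarrow> 0 < lgl_weights G ! m"
    and lgl_weights_sum: "(\<Sum>m<G. lgl_weights G ! m) = 1"
    and lgl_weights_last: "lgl_weights G ! (G - 1) = lgl_weights G ! 0"
    and lgl_point_first: "lgl_point \<Delta>x G j 0 = edge \<Delta>x j"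
    and lgl_point_last: "lgl_point \<Delta>x G j (G - 1) = edge \<Delta>x (j + 1)"
  using assms
  by (auto simp: lgl_weights_def lgl_point_def lgl_nodes_def edge_def less_Suc_eq eval_nat_numeral
      algebra_simps)

lemma quad_size: "quad_size W \<in> {3, 4}"
  by (simp add: quad_size_def)

lemma endpoint_weight_eq: "endpoint_weight W = lgl_weights (quad_size W) ! 0"
  by (simp add: endpoint_weight_def quad_size_def lgl_weights_def)

lemma finite_lgl_points: "finite (lgl_points \<Delta>x G j)"
  by (simp add: lgl_points_def)

lemma weighted_mean_bounds:
  fixes w f :: "nat \<Rightarrow> real"
  assumes "\<And>m. m < G \<Longrightarrow> 0 \<le> w m" "(\<Sum>m<G. w m) = 1"
  shows weighted_mean_ge: "(\<And>m. m < G \<Longrightarrow> c \<le> f m) \<Longrightarrow> c \<le> (\<Sum>m<G. w m * f m)"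
    and weighted_mean_le: "(\<And>m. m < G \<Longrightarrow> f m \<le> c) \<Longrightarrow> (\<Sum>m<G. w m * f m) \<le> c"
proof -
  have c: "(\<Sum>m<G. w m * c) = c" using assms(2) by (simp flip: sum_distrib_right)
  have "(\<Sum>m<G. w m * c) \<le> (\<Sum>m<G. w m * f m)" if "\<And>m. m < G \<Longrightarrow> c \<le> f m"
    by (intro sum_mono mult_left_mono assms that) simp_all
  then show "c \<le> (\<Sum>m<G. w m * f m)" if "\<And>m. m < G \<Longrightarrow> c \<le> f m"
    unfolding c using that .
  have "(\<Sum>m<G. w m * f m) \<le> (\<Sum>m<G. w m * c)" if "\<And>m. m < G \<Longrightarrow> f m \<le> c"
    by (intro sum_mono mult_left_mono assms that) simp_all
  then show "(\<Sum>m<G. w m * f m) \<le> c" if "\<And>m. m < G \<Longrightarrow> f m \<le> c"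
    unfolding c using that .
qed

subsection \<open>Limiter\<close>

text \<open>Both limiters have this form, so neither changes the cell average or raises the degree
  bound, whatever factor is chosen.\<close>

lemma scaled_about_average:
  assumes "0 < \<Delta>x" "degree P \<le> n" "cell_average \<Delta>x j P = a"
  shows degree_scaled_about_average: "degree (smult \<theta> (P - [:a:]) + [:a:]) \<le> n"
    and cell_average_scaled_about_average:
      "cell_average \<Delta>x j (smult \<theta> (P - [:a:]) + [:a:]) = a"
  using assms
  by (auto intro!: degree_add_le order.trans[OF degree_smult_le] degree_diff_le
      simp: cell_average_add cell_average_smult cell_average_diff cell_average_const)

lemma lower_limited:
  fixes U :: "int \<Rightarrow> ('n::finite) state"
  assumes "0 < \<Delta>x" "valid_weno W"
  shows degree_lower_limited: "degree (lower_limited W \<Delta>x \<delta> U j i) \<le> 2 * half_width W"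
    and cell_average_lower_limited: "cell_average \<Delta>x j (lower_limited W \<Delta>x \<delta> U j i) = U j $ i"
  unfolding lower_limited_def Let_def
  by (rule scaled_about_average[OF assms(1) degree_weno_poly[OF assms] cell_average_weno_poly[OF assms]])+

lemma limited:
  fixes U :: "int \<Rightarrow> ('n::finite) state"
  assumes "0 < \<Delta>x" "valid_weno W"
  shows degree_limited: "degree (limited W \<Delta>x \<delta> \<phi>max U j i) \<le> 2 * half_width W"
    and cell_average_limited: "cell_average \<Delta>x j (limited W \<Delta>x \<delta> \<phi>max U j i) = U j $ i"
  unfolding limited_def Let_def
  by (rule scaled_about_average[OF assms(1) degree_lower_limited[OF assms]
        cell_average_lower_limited[OF assms]])+

text \<open>The node count fits the reconstruction: \<open>2 * half_width W\<close> is 2 or 4, while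
  the rule is exact up to degree 3 or 5 respectively.\<close>

lemma weno_quadrature:
  assumes "0 < \<Delta>x" "valid_weno W" "degree P \<le> 2 * half_width W"
  shows "cell_average \<Delta>x j P =
    (\<Sum>m<quad_size W. lgl_weights (quad_size W) ! m * poly P (lgl_point \<Delta>x (quad_size W) j m))"
  using assms by (intro lgl_quadrature) (auto simp: quad_size_def valid_weno_def)

text \<open>The average \<open>a\<close> is a weighted mean of the node values and hence at least
  their minimum \<open>m\<close>. The factor satisfies
  \<open>\<theta> * (a - m) \<le> a - \<delta>\<close>, so no node value drops more than
  \<open>a - \<delta>\<close> below \<open>a\<close>.\<close>

lemma lower_limited_ge:
  fixes U :: "int \<Rightarrow> ('n::finite) state"
  assumes "0 < \<Delta>x" "valid_weno W" "\<delta> \<le> U j $ i" "x \<in> lgl_points \<Delta>x (quad_size W) j"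
  shows "\<delta> \<le> poly (lower_limited W \<Delta>x \<delta> U j i) x"
proof -
  let ?S = "lgl_points \<Delta>x (quad_size W) j"
  define P where "P = weno_poly W \<Delta>x (\<lambda>l. U l $ i) j"
  define a where "a = U j $ i"
  define m where "m = Min (poly P ` ?S)"
  define \<theta> where "\<theta> = (if a = m then 1 else min ((a - \<delta>) / (a - m)) 1)"
  have P: "poly (lower_limited W \<Delta>x \<delta> U j i) x = \<theta> * (poly P x - a) + a"
    by (simp add: lower_limited_def Let_def P_def a_def m_def \<theta>_def)
  have m_le: "m \<le> poly P y" if "y \<in> ?S" for y
    unfolding m_def using that by (intro Min_le) (auto simp: finite_lgl_points)
  have dP: "degree P \<le> 2 * half_width W"
    unfolding P_def by (rule degree_weno_poly[OF assms(1,2)])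
  have "a = cell_average \<Delta>x j P"
    by (simp add: P_def a_def cell_average_weno_poly[OF assms(1,2)])
  also have "\<dots> \<ge> m"
    unfolding weno_quadrature[OF assms(1,2) dP]
    using quad_size[of W]
    by (intro weighted_mean_ge lgl_weights_sum m_le)
       (auto simp: lgl_points_eq less_imp_le lgl_weights_pos simp del: insert_iff)
  finally have "m \<le> a" .
  have "0 \<le> \<theta>" using \<open>m \<le> a\<close> assms(3) by (auto simp: \<theta>_def a_def)
  have "\<theta> * (a - m) \<le> a - \<delta>"
  proof (cases "a = m")
    case False
    then have "\<theta> * (a - m) \<le> (a - \<delta>) / (a - m) * (a - m)"
      using \<open>m \<le> a\<close> by (intro mult_right_mono) (auto simp: \<theta>_def)
    then show ?thesis using False by simp
  qed (use assms(3) a_def in simp)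
  moreover have "\<theta> * (m - a) \<le> \<theta> * (poly P x - a)"
    using m_le[OF assms(4)] \<open>0 \<le> \<theta>\<close> by (intro mult_left_mono) auto
  ultimately show ?thesis unfolding P by (simp add: algebra_simps)
qed

definition limited_state ::
  "weno \<Rightarrow> real \<Rightarrow> real \<Rightarrow> real \<Rightarrow> (int \<Rightarrow> ('n::finite) state) \<Rightarrow> int \<Rightarrow> real \<Rightarrow> 'n state" where
  "limited_state W \<Delta>x \<delta> \<phi>max U j x = (\<chi> i. poly (limited W \<Delta>x \<delta> \<phi>max U j i) x)"

text \<open>The second factor is common to all species, so the total concentration is scaled about
  its own average, and the argument for the lower bound applies with the maximum. Nonnegativity
  survives because each limited value is a convex combination of a lower-limited value and the
  average.\<close>

lemma limited_state_in_state_set: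
  fixes U :: "int \<Rightarrow> ('n::finite) state"
  assumes "0 < \<Delta>x" "valid_weno W" "0 < \<delta>" "\<forall>i. \<delta> \<le> U j $ i" "U j \<in> state_set \<phi>max"
    and "x \<in> lgl_points \<Delta>x (quad_size W) j"
  shows "limited_state W \<Delta>x \<delta> \<phi>max U j x \<in> state_set \<phi>max"
proof -
  let ?S = "lgl_points \<Delta>x (quad_size W) j"
  let ?G = "quad_size W"
  define Q where "Q i = lower_limited W \<Delta>x \<delta> U j i" for i
  define T where "T y = (\<Sum>i\<in>UNIV. poly (Q i) y)" for y
  define A where "A = total_conc (U j)"
  define Mx where "Mx = Max (T ` ?S)"
  define \<theta> where "\<theta> = (if Mx = A then 1 else min \<bar>(\<phi>max - A) / (Mx - A)\<bar> 1)"
  have P: "poly (limited W \<Delta>x \<delta> \<phi>max U j i) x = \<theta> * poly (Q i) x + (1 - \<theta>) * U j $ i" for i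
    by (simp add: limited_def Let_def Q_def T_def A_def Mx_def \<theta>_def algebra_simps)
  have \<theta>: "0 \<le> \<theta>" "\<theta> \<le> 1" by (auto simp: \<theta>_def)
  have T_le: "T y \<le> Mx" if "y \<in> ?S" for y
    unfolding Mx_def using that by (intro Max_ge) (auto simp: finite_lgl_points)
  have "A = (\<Sum>i\<in>UNIV. \<Sum>m<?G. lgl_weights ?G ! m * poly (Q i) (lgl_point \<Delta>x ?G j m))"
    unfolding A_def total_conc_def Q_def
    by (simp add: weno_quadrature[OF assms(1,2) degree_lower_limited[OF assms(1,2)], symmetric]
        cell_average_lower_limited[OF assms(1,2)])
  also have "\<dots> = (\<Sum>m<?G. lgl_weights ?G ! m * T (lgl_point \<Delta>x ?G j m))"
    unfolding T_def sum_distrib_left by (rule sum.swap)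
  also have "\<dots> \<le> Mx"
    using quad_size[of W]
    by (intro weighted_mean_le lgl_weights_sum T_le)
       (auto simp: lgl_points_eq less_imp_le lgl_weights_pos simp del: insert_iff)
  finally have "A \<le> Mx" .
  have A: "A \<le> \<phi>max" using assms(5) by (simp add: A_def state_set_def)
  have "\<theta> * (Mx - A) \<le> \<phi>max - A"
  proof (cases "Mx = A")
    case False
    \<comment> \<open>Here \<open>A < Mx\<close> and \<open>A \<le> \<phi>max\<close>, so the
      quotient is nonnegative and equals its absolute value.\<close>
    then have "\<theta> * (Mx - A) \<le> (\<phi>max - A) / (Mx - A) * (Mx - A)"
      using \<open>A \<le> Mx\<close> A by (intro mult_right_mono) (auto simp: \<theta>_def)
    then show ?thesis using False by simp
  qed (use A in simp)
  moreover have "\<theta> * (T x - A) \<le> \<theta> * (Mx - A)"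
    using T_le[OF assms(6)] \<theta> by (intro mult_left_mono) auto
  moreover have "total_conc (limited_state W \<Delta>x \<delta> \<phi>max U j x) = \<theta> * T x + (1 - \<theta>) * A"
    by (simp add: total_conc_def limited_state_def P T_def A_def sum.distrib sum_distrib_left)
  ultimately have "total_conc (limited_state W \<Delta>x \<delta> \<phi>max U j x) \<le> \<phi>max"
    by (simp add: algebra_simps)
  moreover have "0 \<le> poly (limited W \<Delta>x \<delta> \<phi>max U j i) x" for i
  proof -
    have "\<delta> \<le> poly (Q i) x" unfolding Q_def using assms by (intro lower_limited_ge) auto
    then show ?thesis unfolding P using assms(3,4) \<theta>
      by (intro add_nonneg_nonneg mult_nonneg_nonneg) (auto intro: order.trans[OF less_imp_le])
  qed
  ultimately show ?thesis by (simp add: state_set_def limited_state_def)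
qed

text \<open>The limiter preserves averages and the rule is exact for the limited
  polynomials.\<close>

lemma average_eq_limited_states:
  fixes U :: "int \<Rightarrow> ('n::finite) state"
  assumes "0 < \<Delta>x" "valid_weno W"
  shows "U j = (\<Sum>m<quad_size W. lgl_weights (quad_size W) ! m *\<^sub>R
                  limited_state W \<Delta>x \<delta> \<phi>max U j (lgl_point \<Delta>x (quad_size W) j m))"
  by (simp add: vec_eq_iff limited_state_def cell_average_limited[OF assms]
      weno_quadrature[OF assms degree_limited[OF assms], symmetric])

subsection \<open>Numerical fluxes\<close>

lemma total_conc_algebra [simp]:
  "total_conc 0 = 0"
  "total_conc (X + Y) = total_conc X + total_conc Y"
  "total_conc (X - Y) = total_conc X - total_conc Y"
  "total_conc (c *\<^sub>R X) = c * total_conc X"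
  by (simp_all add: total_conc_def sum.distrib sum_subtractf sum_distrib_left)

text \<open>For positive \<open>c\<close> the set \<open>state_set (c * a)\<close> is
  \<open>state_set a\<close> dilated by \<open>c\<close>. Convex combinations can thus be assembled
  as sums of weighted parts, each lying in its own dilate.\<close>

lemma state_set_add:
  "\<lbrakk>X \<in> state_set a; Y \<in> state_set b\<rbrakk> \<Longrightarrow> X + Y \<in> state_set (a + b)"
  by (auto simp: state_set_def add_mono)

lemma state_set_scale: "\<lbrakk>0 \<le> c; X \<in> state_set a\<rbrakk> \<Longrightarrow> c *\<^sub>R X \<in> state_set (c * a)"
  by (auto simp: state_set_def mult_left_mono)

lemma state_set_sum:
  "(\<And>k. k \<in> K \<Longrightarrow> X k \<in> state_set (a k)) \<Longrightarrow> (\<Sum>k\<in>K. X k) \<in> state_set (\<Sum>k\<in>K. a k)"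
  by (induction K rule: infinite_finite_induct) (auto simp: state_set_add, auto simp: state_set_def)

lemma state_set_segment:
  assumes "X \<in> state_set a" "Y \<in> state_set a" "s \<in> {0..1}"
  shows "s *\<^sub>R Y + (1 - s) *\<^sub>R X \<in> state_set a"
  using state_set_add[OF state_set_scale[of s Y a] state_set_scale[of "1 - s" X a]] assms
  by (simp add: algebra_simps)

text \<open>The last conjunct is what keeps the total concentration below \<open>\<phi>max\<close>: \<open>a\<close> bounds the slope of the
  chord of the total flux from the state to maximal concentration, where the flux vanishes.\<close>

definition speeds_bounded ::
  "real \<Rightarrow> (('n::finite) state \<Rightarrow> 'n state) \<Rightarrow> real \<Rightarrow> real \<Rightarrow> 'n state \<Rightarrow> bool" where
  "speeds_bounded \<phi>max f a b X \<longleftrightarrow>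
     X \<in> state_set \<phi>max \<and> (\<forall>i. a * X $ i \<le> f X $ i \<and> f X $ i \<le> b * X $ i) \<and>
     0 \<le> total_conc (f X) \<and> total_conc (f X) \<le> - a * (\<phi>max - total_conc X)"

text \<open>Lets the speeds at a single state be replaced by the wider ones of an interface. The
  signs of \<open>X $ i\<close> and of \<open>\<phi>max - total_conc X\<close> give the inequalities
  their direction.\<close>

lemma speeds_bounded_mono:
  assumes "speeds_bounded \<phi>max f a b X" "a' \<le> a" "b \<le> b'"
  shows "speeds_bounded \<phi>max f a' b' X"
proof -
  have X: "0 \<le> X $ i" "total_conc X \<le> \<phi>max" for i
    using assms(1) by (auto simp: speeds_bounded_def state_set_def)
  have "a' * X $ i \<le> a * X $ i" "b * X $ i \<le> b' * X $ i" for i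
    using X assms(2,3) by (auto intro: mult_right_mono)
  moreover have "- a * (\<phi>max - total_conc X) \<le> - a' * (\<phi>max - total_conc X)"
    using X assms(2) by (intro mult_right_mono) auto
  ultimately show ?thesis
    using assms(1) unfolding speeds_bounded_def by (meson order.trans)
qed

section \<open>Fluxes with two speeds\<close>

definition two_speed_flux ::
  "(('n::finite) state \<Rightarrow> 'n state) \<Rightarrow> real \<Rightarrow> real \<Rightarrow> 'n state \<Rightarrow> 'n state \<Rightarrow> 'n state" where
  "two_speed_flux f a b X Y = (1 / (b - a)) *\<^sub>R (b *\<^sub>R f X - a *\<^sub>R f Y + (a * b) *\<^sub>R (Y - X))"

lemma hll_flux_eq: "hll_flux f SL SR = two_speed_flux f (min SL 0) (max SR 0)"
  by (simp add: fun_eq_iff hll_flux_def two_speed_flux_def Let_def)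

text \<open>If \<open>s = 0\<close> then the fluxes of both states vanish, so the identity survives the division by
  zero on the right-hand side.\<close>

lemma llf_flux_eq:
  assumes "s = max \<bar>SL\<bar> \<bar>SR\<bar>" "speeds_bounded \<phi>max f (- s) s X" "speeds_bounded \<phi>max f (- s) s Y"
  shows "llf_flux f SL SR X Y = two_speed_flux f (- s) s X Y"
proof (cases "s = 0")
  case True
  then have "f X = 0" "f Y = 0"
    using assms(2,3) by (auto simp: speeds_bounded_def vec_eq_iff intro: order.antisym)
  then show ?thesis using True assms(1) by (simp add: llf_flux_def two_speed_flux_def)
next
  case False
  then show ?thesis
    unfolding llf_flux_def two_speed_flux_def assms(1)[symmetric]
    by (simp add: vec_eq_iff field_simps)
qed

text \<open>With \<open>p = lb/(b - a)\<close> and \<open>q = -la/(b - a)\<close> the flux times \<open>l\<close> is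
  \<open>p (f X - a X) - q (b Y - f Y)\<close>, and both brackets have nonnegative components.\<close>

lemma two_speed_flux_updates:
  fixes f :: "('n::finite) state \<Rightarrow> 'n state"
  assumes "a \<le> 0" "0 \<le> b" "0 \<le> l" "l * b \<le> w" "l * - a \<le> w"
    and X: "speeds_bounded \<phi>max f a b X" and Y: "speeds_bounded \<phi>max f a b Y"
  shows two_speed_flux_outflow: "w *\<^sub>R X - l *\<^sub>R two_speed_flux f a b X Y \<in> state_set (w * \<phi>max)"
    and two_speed_flux_inflow: "w *\<^sub>R Y + l *\<^sub>R two_speed_flux f a b X Y \<in> state_set (w * \<phi>max)"
proof -
  define p q where "p = l * b / (b - a)" and "q = l * - a / (b - a)"
  \<comment> \<open>If \<open>a = b\<close>, both are 0, and division by zero makes \<open>p\<close>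
    and \<open>q\<close> vanish, so the relations hold in this case too.\<close>
  have pq: "0 \<le> p" "0 \<le> q" "p * - a = q * b" "p * (b - a) \<le> w" "q * (b - a) \<le> w"
    using assms(1-5)
    by (auto simp: p_def q_def divide_nonneg_nonneg divide_nonpos_nonneg mult_nonneg_nonpos)
  have pa: "p * a * z = - (q * b * z)" for z by (simp flip: pq(3))
  have "l *\<^sub>R two_speed_flux f a b X Y = p *\<^sub>R f X + q *\<^sub>R f Y - (q * b) *\<^sub>R (Y - X)"
    by (cases "b = a") (simp_all add: two_speed_flux_def p_def q_def vec_eq_iff field_simps)
  also have "\<dots> = p *\<^sub>R (f X - a *\<^sub>R X) - q *\<^sub>R (b *\<^sub>R Y - f Y)"
    using pa[of "X $ i" for i] by (simp add: vec_eq_iff algebra_simps)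
  finally have F: "l *\<^sub>R two_speed_flux f a b X Y = p *\<^sub>R (f X - a *\<^sub>R X) - q *\<^sub>R (b *\<^sub>R Y - f Y)" .
  \<comment> \<open>Both brackets lie between 0 and \<open>b - a\<close> times the component of the
    state, and \<open>p * (b - a)\<close> and \<open>q * (b - a)\<close> are at most
    \<open>w\<close>.\<close>
  have comp: "p * (f X $ i - a * X $ i) \<le> w * X $ i" "0 \<le> p * (f X $ i - a * X $ i)"
    "q * (b * Y $ i - f Y $ i) \<le> w * Y $ i" "0 \<le> q * (b * Y $ i - f Y $ i)" for i
  proof -
    have x: "0 \<le> X $ i" "0 \<le> Y $ i" "a * X $ i \<le> f X $ i" "f X $ i \<le> b * X $ i"
      "a * Y $ i \<le> f Y $ i" "f Y $ i \<le> b * Y $ i"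
      using X Y by (auto simp: speeds_bounded_def state_set_def)
    have "p * (f X $ i - a * X $ i) \<le> p * ((b - a) * X $ i)"
      using x pq(1) by (intro mult_left_mono) (auto simp: algebra_simps)
    also have "\<dots> \<le> w * X $ i"
      unfolding mult.assoc[symmetric] using x pq(4) by (intro mult_right_mono) auto
    finally show "p * (f X $ i - a * X $ i) \<le> w * X $ i" .
    have "q * (b * Y $ i - f Y $ i) \<le> q * ((b - a) * Y $ i)"
      using x pq(2) by (intro mult_left_mono) (auto simp: algebra_simps)
    also have "\<dots> \<le> w * Y $ i"
      unfolding mult.assoc[symmetric] using x pq(5) by (intro mult_right_mono) auto
    finally show "q * (b * Y $ i - f Y $ i) \<le> w * Y $ i" .
    show "0 \<le> p * (f X $ i - a * X $ i)" "0 \<le> q * (b * Y $ i - f Y $ i)"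
      using x pq by simp_all
  qed
  define x y fx fy where "x = total_conc X" "y = total_conc Y"
    "fx = total_conc (f X)" "fy = total_conc (f Y)"
  note defs = this
  have tot: "x \<le> \<phi>max" "y \<le> \<phi>max" "0 \<le> fx" "0 \<le> fy" "fx \<le> - a * (\<phi>max - x)" "fy \<le> - a * (\<phi>max - y)"
    using X Y by (auto simp: speeds_bounded_def state_set_def defs)
  \<comment> \<open>By \<open>p * a = - (q * b)\<close> the left side is
    \<open>(w - q * b) * x + q * b * y - p * fx - q * fy\<close>. The total fluxes are nonnegative,
    and \<open>x\<close> and \<open>y\<close> carry nonnegative weights with sum
    \<open>w\<close>.\<close>
  have "w * x - p * (fx - a * x) + q * (b * y - fy) \<le> w * \<phi>max"
  proof -
    have "0 \<le> p * fx" "0 \<le> q * fy" "q * b * y \<le> q * b * \<phi>max"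
      using pq tot assms(2) by (auto intro!: mult_left_mono)
    moreover have "(w - q * b) * x \<le> (w - q * b) * \<phi>max"
    proof (intro mult_left_mono tot)
      have "q * b \<le> q * (b - a)" using pq assms(1) by (intro mult_left_mono) auto
      then show "0 \<le> w - q * b" using pq by linarith
    qed
    ultimately show ?thesis using pa[of x] by (simp add: algebra_simps)
  qed
  moreover have out: "p * (f X $ i - a * X $ i) - q * (b * Y $ i - f Y $ i) \<le> w * X $ i" for i
    using comp(1)[of i] comp(4)[of i] by linarith
  ultimately show "w *\<^sub>R X - l *\<^sub>R two_speed_flux f a b X Y \<in> state_set (w * \<phi>max)"
    unfolding F state_set_def using out by (simp add: defs)
  \<comment> \<open>Now the total fluxes enter with a plus sign and the chord bounds are needed.
    Inserting them cancels \<open>x\<close> and leaves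
    \<open>(w - q * (b - a)) * y + q * (b - a) * \<phi>max\<close>.\<close>
  have "w * y + p * (fx - a * x) - q * (b * y - fy) \<le> w * \<phi>max"
  proof -
    have "p * fx \<le> p * (- a * (\<phi>max - x))" "q * fy \<le> q * (- a * (\<phi>max - y))"
      using mult_left_mono[OF tot(5) pq(1)] mult_left_mono[OF tot(6) pq(2)] by simp_all
    moreover have "(w - q * (b - a)) * y \<le> (w - q * (b - a)) * \<phi>max"
      using pq tot by (intro mult_left_mono) auto
    ultimately show ?thesis using pa[of \<phi>max] pa[of x] by (simp add: algebra_simps)
  qed
  moreover have inn: "q * (b * Y $ i - f Y $ i) \<le> w * Y $ i + p * (f X $ i - a * X $ i)" for i
    using comp(2)[of i] comp(3)[of i] by linarith
  ultimately show "w *\<^sub>R Y + l *\<^sub>R two_speed_flux f a b X Y \<in> state_set (w * \<phi>max)"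
    unfolding F state_set_def using inn by (simp add: defs add_diff_eq)
qed

subsection \<open>Velocity bounds of the models\<close>

text \<open>Continuity, or the two one-sided limits at an exceptional point, bound the function near
  each point; compactness makes the bound global.\<close>

lemma pw_continuous_on_imp_bounded:
  assumes "pw_continuous_on a b g"
  shows "bounded (g ` {a..b})"
proof -
  obtain T where T: "finite T" "\<And>x. x \<in> {a..b} - T \<Longrightarrow> continuous (at x within {a..b}) g"
    "\<And>x. x \<in> T \<Longrightarrow> (\<exists>l. (g \<longlongrightarrow> l) (at x within {a..<x})) \<and> (\<exists>l. (g \<longlongrightarrow> l) (at x within {x<..b}))"
    using assms unfolding pw_continuous_on_def by blast
  have "\<exists>K U. open U \<and> x \<in> U \<and> (\<forall>y\<in>U \<inter> {a..b}. norm (g y) \<le> K)" if x: "x \<in> {a..b}" for x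
  proof -
    have bnd: "\<exists>K. eventually (\<lambda>y. norm (g y) \<le> K) F" if "(g \<longlongrightarrow> l) F" for l F
    proof -
      have "eventually (\<lambda>y. norm (g y) < norm l + 1) F"
        using tendsto_norm[OF that] by (rule order_tendstoD) simp
      then show ?thesis by (auto intro!: exI[of _ "norm l + 1"] elim: eventually_mono)
    qed
    have "\<exists>K. eventually (\<lambda>y. norm (g y) \<le> K) (at x within {a..b})"
    proof (cases "x \<in> T")
      case True
      then obtain K1 K2 where "eventually (\<lambda>y. norm (g y) \<le> K1) (at x within {a..<x})"
        "eventually (\<lambda>y. norm (g y) \<le> K2) (at x within {x<..b})"
        using T(3) bnd by meson
      then have "eventually (\<lambda>y. norm (g y) \<le> max K1 K2) (at x within {a..<x} \<union> {x<..b})"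
        unfolding at_within_union eventually_sup by (auto elim: eventually_mono)
      moreover have "at x within {a..b} = at x within {a..<x} \<union> {x<..b}"
      proof -
        have "{a..b} - {x} = ({a..<x} \<union> {x<..b}) - {x}" using x by auto
        then show ?thesis by (simp add: at_within_def)
      qed
      ultimately show ?thesis by auto
    next
      case False
      then show ?thesis using bnd T(2)[of x] x by (auto simp: continuous_within)
    qed
    then obtain K U where U: "open U" "x \<in> U" "\<forall>y\<in>U. y \<noteq> x \<longrightarrow> y \<in> {a..b} \<longrightarrow> norm (g y) \<le> K"
      unfolding eventually_at_topological by blast
    \<comment> \<open>The filter ignores \<open>x\<close> itself, so the value there enters the
      local bound separately.\<close>
    then show ?thesis by (intro exI[of _ "max K (norm (g x))"] exI[of _ U]) (auto simp: le_max_iff_disj)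
  qed
  then obtain K U where KU: "\<And>x. x \<in> {a..b} \<Longrightarrow> open (U x) \<and> x \<in> U x \<and> (\<forall>y\<in>U x \<inter> {a..b}. norm (g y) \<le> K x)"
    by metis
  then obtain D where D: "D \<subseteq> {a..b}" "finite D" "{a..b} \<subseteq> (\<Union>x\<in>D. U x)"
    using compactE_image[of "{a..b}" "{a..b}" U] by (metis UN_I compact_Icc subsetI)
  \<comment> \<open>The sum dominates every local bound and makes sense for an empty cover as
    well.\<close>
  have "norm (g y) \<le> (\<Sum>x\<in>D. \<bar>K x\<bar>)" if y: "y \<in> {a..b}" for y
  proof -
    obtain x where x: "x \<in> D" "y \<in> U x" using D(3) y by blast
    then have "norm (g y) \<le> K x" using KU[of x] D(1) y by blast
    also have "\<dots> \<le> \<bar>K x\<bar>" by simp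
    also have "\<dots> \<le> (\<Sum>x\<in>D. \<bar>K x\<bar>)" using x(1) D(2) by (intro member_le_sum) auto
    finally show ?thesis .
  qed
  then show ?thesis unfolding bounded_iff by blast
qed

text \<open>The increment of \<open>w\<close> is the integral of \<open>w'\<close> across the
  finitely many kinks, and monotonicity bounds the integrand by its end values. This covers end
  points at kinks, where \<open>w'\<close> need not be a derivative.\<close>

lemma pw_derivative_chord:
  assumes "has_pw_derivative_on w w' {0..c}" "mono_on {0..c} w'" "0 \<le> x" "x \<le> y" "y \<le> c"
  shows pw_derivative_chord_ge: "w' x * (y - x) \<le> w y - w x"
    and pw_derivative_chord_le: "w y - w x \<le> w' y * (y - x)"
proof -
  have "continuous_on {0..c} w" using assms(1)
    by (simp add: has_pw_derivative_on_def piecewise_differentiable_on_def)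
  obtain S where S: "finite S" "\<And>z. z \<in> {0..c} - S \<Longrightarrow> w differentiable (at z within {0..c})"
    using assms(1) by (auto simp: has_pw_derivative_on_def piecewise_differentiable_on_def)
  have I: "(w' has_integral (w y - w x)) {x..y}"
  proof (rule fundamental_theorem_of_calculus_interior_strong[OF S(1) \<open>x \<le> y\<close>])
    show "(w has_vector_derivative w' z) (at z)" if "z \<in> {x<..<y} - S" for z
    proof -
      have "(w has_real_derivative w' z) (at z within {0..c})"
        using assms(1,3-5) S(2)[of z] that by (auto simp: has_pw_derivative_on_def)
      moreover have "at z within {0..c} = at z"
        using that assms(3,5) by (intro at_within_Icc_at) auto
      ultimately show ?thesis by (simp add: has_real_derivative_iff_has_vector_derivative)
    qed
    show "continuous_on {x..y} w"
      using \<open>continuous_on {0..c} w\<close> assms(3,5) by (auto intro: continuous_on_subset)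
  qed
  have "((\<lambda>z. w' x) has_integral w' x * (y - x)) {x..y}" "((\<lambda>z. w' y) has_integral w' y * (y - x)) {x..y}"
    using has_integral_const_real[of "w' x" x y] has_integral_const_real[of "w' y" x y] assms(4)
    by (simp_all add: mult.commute)
  then show "w' x * (y - x) \<le> w y - w x" "w y - w x \<le> w' y * (y - x)"
    using assms(3-5)
    by (auto intro!: has_integral_le[OF _ I] has_integral_le[OF I] mono_onD[OF assms(2)])
qed

section \<open>Bounds on states, total flux and lower speed\<close>

lemma state_set_bounds:
  assumes "X \<in> state_set \<phi>max"
  shows state_set_nonneg: "0 \<le> X $ i"
    and total_conc_Icc: "total_conc X \<in> {0..\<phi>max}"
    and state_set_le: "X $ i \<le> \<phi>max"
proof -
  show "0 \<le> X $ i" using assms by (simp add: state_set_def)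
  have "X $ i \<le> total_conc X"
    unfolding total_conc_def using assms by (intro member_le_sum) (auto simp: state_set_def)
  then show "X $ i \<le> \<phi>max" using assms by (simp add: state_set_def)
  show "total_conc X \<in> {0..\<phi>max}"
    using assms by (auto simp: state_set_def total_conc_def intro: sum_nonneg)
qed

lemma inner_state_set_bounds:
  fixes \<kappa> :: "('n::finite) state"
  assumes "\<forall>i. 0 < \<kappa> $ i" "X \<in> state_set \<phi>max"
  shows inner_state_set_nonneg: "0 \<le> \<kappa> \<bullet> X"
    and inner_state_set_le: "\<kappa> \<bullet> X \<le> (\<Sum>i\<in>UNIV. \<kappa> $ i * \<phi>max)"
  using assms(1) state_set_nonneg[OF assms(2)] state_set_le[OF assms(2)]
  by (auto simp: inner_vec_def less_imp_le intro!: sum_nonneg sum_mono mult_left_mono)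

text \<open>Convexity of \<open>w\<close> together with \<open>w \<phi>max = 0\<close> and \<open>\<psi> \<le> w'\<close> gives \<open>w x \<le> - \<psi> x (\<phi>max - x)\<close>.\<close>

lemma total_phys_flux_bounds:
  fixes v :: "('n::{finite,linorder}) state \<Rightarrow> 'n state"
  assumes "w_properties \<phi>max v \<kappa> w w' \<psi>" "X \<in> state_set \<phi>max"
  shows "0 \<le> total_conc (phys_flux v X)"
    and "total_conc (phys_flux v X) \<le> - (\<psi> (total_conc X) * (\<kappa> \<bullet> X)) * (\<phi>max - total_conc X)"
proof -
  define x where "x = total_conc X"
  have x: "0 \<le> x" "x \<le> \<phi>max" using total_conc_Icc[OF assms(2)] by (auto simp: x_def)
  note W = assms(1)[unfolded w_properties_def]
  have F: "total_conc (phys_flux v X) = w x * (\<kappa> \<bullet> X)"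
    using W assms(2) by (simp add: total_conc_def phys_flux_def x_def)
  have k: "0 \<le> \<kappa> \<bullet> X" using W assms(2) by (intro inner_state_set_nonneg) auto
  have "0 \<le> w x" using W x by auto
  then show "0 \<le> total_conc (phys_flux v X)" using F k by simp
  have "w' x * (\<phi>max - x) \<le> w \<phi>max - w x"
    using W x by (intro pw_derivative_chord_ge) auto
  moreover have "\<psi> x * (\<phi>max - x) \<le> w' x * (\<phi>max - x)"
    using W assms(2) x by (intro mult_right_mono) (auto simp: x_def)
  ultimately have "w x \<le> - (\<psi> x * (\<phi>max - x))" using W by linarith
  from mult_right_mono[OF this k]
  show "total_conc (phys_flux v X) \<le> - (\<psi> (total_conc X) * (\<kappa> \<bullet> X)) * (\<phi>max - total_conc X)"
    by (simp add: F x_def[symmetric] mult_ac)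
qed

text \<open>Both factors are bounded on the state set. An infimum of reals is a lower bound only if
  the set is bounded below, so \<open>speed_L\<close> can be used only with this fact.\<close>

lemma bdd_below_lower_speed:
  fixes v :: "('n::{finite,linorder}) state \<Rightarrow> 'n state"
  assumes "w_properties \<phi>max v \<kappa> w w' \<psi>"
  shows "bdd_below ((\<lambda>X. \<psi> (total_conc X) * (\<kappa> \<bullet> X)) ` state_set \<phi>max)"
proof -
  have "bounded (\<psi> ` {0..\<phi>max})"
    using assms by (intro pw_continuous_on_imp_bounded) (simp add: w_properties_def)
  then obtain K where K: "\<And>x. x \<in> {0..\<phi>max} \<Longrightarrow> \<bar>\<psi> x\<bar> \<le> K"
    unfolding bounded_iff by (metis imageI real_norm_def)
  have "- (K * (\<Sum>i\<in>UNIV. \<kappa> $ i * \<phi>max)) \<le> \<psi> (total_conc X) * (\<kappa> \<bullet> X)"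
    if X: "X \<in> state_set \<phi>max" for X
  proof -
    have k: "0 \<le> \<kappa> \<bullet> X" "\<kappa> \<bullet> X \<le> (\<Sum>i\<in>UNIV. \<kappa> $ i * \<phi>max)"
      using assms X by (auto simp: w_properties_def intro!: inner_state_set_nonneg inner_state_set_le)
    have "- \<psi> (total_conc X) * (\<kappa> \<bullet> X) \<le> K * (\<kappa> \<bullet> X)"
      using K[OF total_conc_Icc[OF X]] k by (intro mult_right_mono) auto
    also have "\<dots> \<le> K * (\<Sum>i\<in>UNIV. \<kappa> $ i * \<phi>max)"
      using K[OF total_conc_Icc[OF X]] k by (intro mult_left_mono) auto
    finally show ?thesis by simp
  qed
  then show ?thesis by (intro bdd_belowI2)
qed

lemma pw_derivative_bdd_above:
  assumes "has_pw_derivative_on u u' {0..c}"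
  obtains B where "\<And>x. x \<in> {0..c} \<Longrightarrow> u x \<le> B"
proof -
  have "compact (u ` {0..c})"
    using assms by (intro compact_continuous_image compact_Icc)
      (simp add: has_pw_derivative_on_def piecewise_differentiable_on_def)
  then obtain B where "\<forall>y\<in>u ` {0..c}. \<bar>y\<bar> \<le> B"
    by (auto dest!: compact_imp_bounded simp: bounded_iff)
  then show ?thesis by (intro that[of B]) (auto simp: abs_le_iff)
qed

section \<open>Velocities in the two models\<close>

text \<open>All that the flux estimates use of a particular model. The boundedness of
  \<open>M2\<close> makes the supremum in \<open>speed_R\<close> an actual upper bound.\<close>

definition velocity_bounds ::
  "real \<Rightarrow> (('n::{finite,linorder}) state \<Rightarrow> 'n state) \<Rightarrow> (real \<Rightarrow> real) \<Rightarrow> 'n state \<Rightarrow> ('n state \<Rightarrow> real) \<Rightarrow> bool"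
where
  "velocity_bounds \<phi>max v \<psi> \<kappa> M2 \<longleftrightarrow>
     (\<forall>X\<in>state_set \<phi>max. \<forall>i. \<psi> (total_conc X) * (\<kappa> \<bullet> X) \<le> v X $ i \<and> v X $ i \<le> M2 X) \<and>
     bdd_above (M2 ` state_set \<phi>max)"

text \<open>As \<open>u' \<le> 0\<close>, the lower speed is nonpositive while the velocities are
  nonnegative. The first species has the largest factor and gives the upper speed.\<close>

lemma mclwr_velocity_bounds:
  fixes v :: "('n::{finite,linorder}) state \<Rightarrow> 'n state"
  assumes "mclwr_model \<phi>max v \<kappa> w \<psi> M2"
  shows "velocity_bounds \<phi>max v \<psi> \<kappa> M2"
proof -
  from assms obtain \<beta> :: "'n state" and u u' where
    dec: "\<And>i j. i < j \<Longrightarrow> \<beta> $ j < \<beta> $ i" and pos: "\<forall>i. 0 < \<beta> $ i"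
    and du: "has_pw_derivative_on u u' {0..\<phi>max}"
    and u: "\<forall>x\<in>{0..<\<phi>max}. 0 < u x" "u \<phi>max = 0" "\<forall>x\<in>{0..\<phi>max}. u' x \<le> 0"
    and v: "\<forall>X\<in>state_set \<phi>max. v X = u (total_conc X) *\<^sub>R \<beta>"
    and M2: "\<forall>X\<in>state_set \<phi>max. M2 X = \<beta> $ Min UNIV * u (total_conc X)"
    and \<kappa>: "\<kappa> = \<beta>" and \<psi>: "\<forall>x\<in>{0..\<phi>max}. \<psi> x = u' x"
    unfolding mclwr_model_def by blast
  have unn: "0 \<le> u x" if "x \<in> {0..\<phi>max}" for x
    using u that by (cases "x = \<phi>max") (auto intro: less_imp_le)
  have \<beta>1: "\<beta> $ i \<le> \<beta> $ Min UNIV" for i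
    using dec[of "Min UNIV" i] by (cases "i = Min UNIV") (auto simp: less_le)
  obtain B where B: "\<And>x. x \<in> {0..\<phi>max} \<Longrightarrow> u x \<le> B"
    using pw_derivative_bdd_above[OF du] by blast
  show ?thesis
    unfolding velocity_bounds_def
  proof (intro conjI ballI allI)
    fix X :: "'n state" and i assume X: "X \<in> state_set \<phi>max"
    note x = total_conc_Icc[OF X]
    have "\<psi> (total_conc X) * (\<kappa> \<bullet> X) \<le> 0"
      using inner_state_set_nonneg[OF pos X] u(3) \<psi> x \<kappa> by (simp add: mult_nonpos_nonneg)
    also have "0 \<le> v X $ i" using v X unn[OF x] pos by (simp add: less_imp_le)
    finally show "\<psi> (total_conc X) * (\<kappa> \<bullet> X) \<le> v X $ i" .
    show "v X $ i \<le> M2 X"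
      using v M2 X mult_right_mono[OF \<beta>1[of i] unn[OF x]] by (simp add: mult.commute)
  next
    have "M2 X \<le> \<beta> $ Min UNIV * B" if "X \<in> state_set \<phi>max" for X
      using M2 that B[OF total_conc_Icc[OF that]] pos by (simp add: mult_left_mono less_imp_le)
    then show "bdd_above (M2 ` state_set \<phi>max)" by (intro bdd_aboveI2)
  qed
qed

text \<open>For \<open>\<phi>max > 1\<close> the function \<open>w\<close> vanishes at \<open>1\<close> and at \<open>\<phi>max\<close>, and by convexity in between; then
  \<open>C = 0\<close>.\<close>

lemma mlb_hindrance_nonneg:
  assumes "has_pw_derivative_on w w' {0..\<phi>max}" "mono_on {0..\<phi>max} w'" "w \<phi>max = 0" "0 < \<phi>max"
    and w: "\<forall>x\<in>{0..\<phi>max}. w x = C * (1 - x)\<^sup>2 * V x" "\<forall>x\<in>{0..\<phi>max}. 0 \<le> w x"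
    and V: "\<forall>x\<in>{0..<\<phi>max}. 0 < V x"
  shows "0 \<le> C" and "x \<in> {0..\<phi>max} \<Longrightarrow> 0 \<le> C * (1 - x)"
proof -
  have "0 \<le> C * V 0" "0 < V 0" using w[THEN bspec, of 0] V assms(4) by auto
  then show C: "0 \<le> C" by (simp add: zero_le_mult_iff)
  have C0: "C = 0" if gt: "1 < \<phi>max"
  proof -
    \<comment> \<open>The midpoint of \<open>1\<close> and \<open>\<phi>max\<close>: the chords on
      its two sides have equal length, so their slope bounds combine to
      \<open>w y \<le> - w y\<close>.\<close>
    define y where "y = (1 + \<phi>max) / 2"
    have y: "1 < y" "y < \<phi>max" using gt by (auto simp: y_def)
    have "w 1 = 0" using w gt by simp
    moreover have "w y - w 1 \<le> w' y * (y - 1)" "w' y * (\<phi>max - y) \<le> w \<phi>max - w y"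
      using y assms(1,2) by (auto intro!: pw_derivative_chord_le pw_derivative_chord_ge)
    moreover have "y - 1 = \<phi>max - y" by (simp add: y_def field_simps)
    ultimately have "w y \<le> 0" using assms(3) by simp
    then have "C * ((1 - y)\<^sup>2 * V y) \<le> 0" using w(1)[THEN bspec, of y] y by simp
    moreover have "0 < (1 - y)\<^sup>2 * V y" using y V by simp
    ultimately show ?thesis using C by (metis mult_pos_pos not_le order_le_imp_less_or_eq)
  qed
  show "0 \<le> C * (1 - x)" if "x \<in> {0..\<phi>max}"
    using C C0 that by (cases "1 < \<phi>max") auto
qed

text \<open>With \<open>H = C * (1 - x) * V x \<ge> 0\<close> at total concentration
  \<open>x\<close>, the velocities are \<open>H * \<delta> $ i - H * (\<delta> \<bullet> X)\<close>.
  The lower bound follows from \<open>\<psi> x \<le> - H\<close>, the upper one from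
  \<open>\<delta>\<close> being largest, with value 1, at the first species.\<close>

lemma mlb_velocity_bounds:
  fixes v :: "('n::{finite,linorder}) state \<Rightarrow> 'n state"
  assumes "mlb_model \<phi>max v \<kappa> w \<psi> M2" "w_properties \<phi>max v \<kappa> w w' \<psi>" "0 < \<phi>max"
  shows "velocity_bounds \<phi>max v \<psi> \<kappa> M2"
proof -
  from assms(1) obtain d \<delta> :: "'n state" and C V V' where
    dec: "\<And>i j. i < j \<Longrightarrow> d $ j < d $ i" and dpos: "\<And>i. 0 < d $ i"
    and \<delta>: "\<delta> = (\<chi> i. (d $ i)\<^sup>2 / (d $ Min UNIV)\<^sup>2)"
    and dV: "has_pw_derivative_on V V' {0..\<phi>max}"
    and V: "\<forall>x\<in>{0..<\<phi>max}. 0 < V x" "V \<phi>max = 0" "\<forall>x\<in>{0..\<phi>max}. V' x \<le> 0"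
    and v: "\<forall>X\<in>state_set \<phi>max.
      v X = (\<chi> i. C * (1 - total_conc X) * V (total_conc X) * (\<delta> $ i - \<delta> \<bullet> X))"
    and M2: "\<forall>X\<in>state_set \<phi>max. M2 X = v X $ Min UNIV"
    and \<kappa>: "\<kappa> = \<delta>"
    and w: "\<forall>x\<in>{0..\<phi>max}. w x = C * (1 - x)\<^sup>2 * V x"
    and \<psi>: "\<forall>x\<in>{0..\<phi>max}. \<psi> x = C * ((1 - x) * V' x - 2 * V x)"
    unfolding mlb_model_def by blast
  note W = assms(2)[unfolded w_properties_def]
  have Cnn: "0 \<le> C" and hind: "\<And>x. x \<in> {0..\<phi>max} \<Longrightarrow> 0 \<le> C * (1 - x)"
    using mlb_hindrance_nonneg[of w w' \<phi>max C V] W w V(1) assms(3) by auto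
  have Vnn: "0 \<le> V x" if "x \<in> {0..\<phi>max}" for x
    using V that by (cases "x = \<phi>max") (auto intro: less_imp_le)
  have \<delta>1: "\<delta> $ Min UNIV = 1" using dpos[of "Min UNIV"] by (simp add: \<delta>)
  have "d $ i \<le> d $ Min UNIV" for i
    using dec[of "Min UNIV" i] by (cases "i = Min UNIV") (auto simp: less_le)
  then have \<delta>le: "\<delta> $ i \<le> \<delta> $ Min UNIV" for i
    by (simp add: \<delta> divide_right_mono power_mono less_imp_le[OF dpos])
  have \<delta>pos: "\<forall>i. 0 < \<delta> $ i" using dpos by (simp add: \<delta> less_imp_neq[symmetric] dual_order.strict_implies_not_eq)
  obtain B where B: "\<And>x. x \<in> {0..\<phi>max} \<Longrightarrow> V x \<le> B"
    using pw_derivative_bdd_above[OF dV] by blast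
  have *: "\<psi> x * k \<le> - (C * (1 - x) * V x * k)" "C * (1 - x) * V x \<le> C * B"
    "0 \<le> C * (1 - x) * V x" if "x \<in> {0..\<phi>max}" "0 \<le> k" for x k
  proof -
    show "0 \<le> C * (1 - x) * V x" using hind[OF that(1)] Vnn[OF that(1)] by simp
    have le: "C * (1 - x) \<le> C" using Cnn that by (simp add: mult_left_le)
    have CV: "C * (1 - x) * V x \<le> C * V x" using le Vnn[OF that(1)] by (rule mult_right_mono)
    also have "\<dots> \<le> C * B" using B[OF that(1)] Cnn by (rule mult_left_mono)
    finally show "C * (1 - x) * V x \<le> C * B" .
    have "C * (1 - x) * V' x \<le> 0" using hind V(3) that by (simp add: mult_nonneg_nonpos)
    moreover have "0 \<le> C * V x" using Cnn Vnn[OF that(1)] by simp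
    moreover have "\<psi> x = C * (1 - x) * V' x - 2 * (C * V x)"
      using \<psi>[THEN bspec, OF that(1)] by (simp add: algebra_simps)
    \<comment> \<open>Dropping the nonpositive derivative term leaves
      \<open>- 2 * (C * V x)\<close>, which is at most \<open>- (C * V x)\<close>; and
      \<open>C * (1 - x) * V x \<le> C * V x\<close>.\<close>
    ultimately have "\<psi> x \<le> - (C * (1 - x) * V x)" using CV by linarith
    from mult_right_mono[OF this that(2)] show "\<psi> x * k \<le> - (C * (1 - x) * V x * k)" by simp
  qed
  show ?thesis
    unfolding velocity_bounds_def
  proof (intro conjI ballI allI)
    fix X :: "'n state" and i assume X: "X \<in> state_set \<phi>max"
    define H where "H = C * (1 - total_conc X) * V (total_conc X)"
    have k: "0 \<le> \<delta> \<bullet> X" using inner_state_set_nonneg[OF \<delta>pos X] .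
    note b = *[OF total_conc_Icc[OF X] k, folded H_def]
    have vX: "v X $ i = H * \<delta> $ i - H * (\<delta> \<bullet> X)" for i using v X by (simp add: H_def algebra_simps)
    have "0 \<le> H * \<delta> $ i" using b(3) \<delta>pos by (simp add: less_imp_le)
    then show "\<psi> (total_conc X) * (\<kappa> \<bullet> X) \<le> v X $ i" using b(1) by (simp add: vX \<kappa>)
    show "v X $ i \<le> M2 X" using M2 X b(3) \<delta>le by (simp add: vX mult_left_mono)
  next
    have "M2 X \<le> C * B" if X: "X \<in> state_set \<phi>max" for X
    proof -
      define H where "H = C * (1 - total_conc X) * V (total_conc X)"
      have k: "0 \<le> \<delta> \<bullet> X" using inner_state_set_nonneg[OF \<delta>pos X] .
      note b = *[OF total_conc_Icc[OF X] k, folded H_def]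
      have "M2 X = H - H * (\<delta> \<bullet> X)" using M2 v X \<delta>1 by (simp add: H_def algebra_simps)
      also have "\<dots> \<le> H" using b(3) k by simp
      finally show ?thesis using b(2) by simp
    qed
    then show "bdd_above (M2 ` state_set \<phi>max)" by (intro bdd_aboveI2)
  qed
qed

subsection \<open>One time step\<close>

lemma segment_image_subset:
  assumes "X \<in> state_set c" "Y \<in> state_set c"
  shows "(\<lambda>s. g (s *\<^sub>R Y + (1 - s) *\<^sub>R X)) ` {0..1} \<subseteq> g ` state_set c"
  using state_set_segment[OF assms] by blast

text \<open>The values \<open>s = 0\<close> and \<open>s = 1\<close> give the two states, and
  convexity keeps the segment between them in the state set, where boundedness is known.\<close>

lemma speed_L_le:
  assumes "bdd_below ((\<lambda>X. \<psi> (total_conc X) * (\<kappa> \<bullet> X)) ` state_set c)"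
    and "X \<in> state_set c" "Y \<in> state_set c"
  shows "speed_L \<psi> \<kappa> X Y \<le> \<psi> (total_conc X) * (\<kappa> \<bullet> X)"
    and "speed_L \<psi> \<kappa> X Y \<le> \<psi> (total_conc Y) * (\<kappa> \<bullet> Y)"
proof -
  define g where "g = (\<lambda>X. \<psi> (total_conc X) * (\<kappa> \<bullet> X))"
  have "bdd_below ((\<lambda>s. g (s *\<^sub>R Y + (1 - s) *\<^sub>R X)) ` {0..1})"
    using assms(1) segment_image_subset[OF assms(2,3)] unfolding g_def by (rule bdd_below_mono)
  from cINF_lower[OF this, of 0] cINF_lower[OF this, of 1]
  show "speed_L \<psi> \<kappa> X Y \<le> \<psi> (total_conc X) * (\<kappa> \<bullet> X)"
    "speed_L \<psi> \<kappa> X Y \<le> \<psi> (total_conc Y) * (\<kappa> \<bullet> Y)"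
    unfolding speed_L_def Let_def g_def by simp_all
qed

lemma speed_R_ge:
  assumes "bdd_above (M2 ` state_set c)" "X \<in> state_set c" "Y \<in> state_set c"
  shows "M2 X \<le> speed_R M2 X Y" and "M2 Y \<le> speed_R M2 X Y"
proof -
  have "bdd_above ((\<lambda>s. M2 (s *\<^sub>R Y + (1 - s) *\<^sub>R X)) ` {0..1})"
    using assms(1) segment_image_subset[OF assms(2,3)] by (rule bdd_above_mono)
  from cSUP_upper[OF _ this, of 0] cSUP_upper[OF _ this, of 1]
  show "M2 X \<le> speed_R M2 X Y" "M2 Y \<le> speed_R M2 X Y"
    unfolding speed_R_def by simp_all
qed

text \<open>Velocity bounds become flux bounds on multiplication by the nonnegative concentrations;
  the bounds on the total flux come from \<open>w\<close>.\<close>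

lemma speeds_bounded_phys_flux:
  fixes v :: "('n::{finite,linorder}) state \<Rightarrow> 'n state"
  assumes "velocity_bounds \<phi>max v \<psi> \<kappa> M2" "w_properties \<phi>max v \<kappa> w w' \<psi>" "X \<in> state_set \<phi>max"
  shows "speeds_bounded \<phi>max (phys_flux v) (\<psi> (total_conc X) * (\<kappa> \<bullet> X)) (M2 X) X"
  using assms(1,3) total_phys_flux_bounds[OF assms(2,3)] state_set_nonneg[OF assms(3)]
  unfolding speeds_bounded_def velocity_bounds_def phys_flux_def
  by (auto simp: mult.commute[of "X $ _"] intro!: mult_right_mono)

text \<open>Either flux is a two-speed flux whose speeds enclose \<open>SL\<close> and
  \<open>SR\<close> and are at most \<open>s\<close> in absolute value: \<open>- s\<close> and
  \<open>s\<close> for LLF, the speeds cut off at 0 for HLL. The time step condition thus controls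
  both speeds at once.\<close>

lemma num_flux_updates:
  fixes v :: "('n::{finite,linorder}) state \<Rightarrow> 'n state"
  assumes bounds: "velocity_bounds \<phi>max v \<psi> \<kappa> M2" and W: "w_properties \<phi>max v \<kappa> w w' \<psi>"
    and X: "X \<in> state_set \<phi>max" and Y: "Y \<in> state_set \<phi>max"
    and l: "0 \<le> l" "\<bar>speed_L \<psi> \<kappa> X Y\<bar> * l \<le> c" "\<bar>speed_R M2 X Y\<bar> * l \<le> c"
  shows num_flux_outflow:
      "c *\<^sub>R X - l *\<^sub>R num_flux kind (phys_flux v) \<psi> \<kappa> M2 X Y \<in> state_set (c * \<phi>max)"
    and num_flux_inflow:
      "c *\<^sub>R Y + l *\<^sub>R num_flux kind (phys_flux v) \<psi> \<kappa> M2 X Y \<in> state_set (c * \<phi>max)"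
proof -
  let ?f = "phys_flux v"
  define SL SR s where "SL = speed_L \<psi> \<kappa> X Y" "SR = speed_R M2 X Y" "s = max \<bar>SL\<bar> \<bar>SR\<bar>"
  note defs = this
  have "bdd_above (M2 ` state_set \<phi>max)" using bounds by (simp add: velocity_bounds_def)
  note R = speed_R_ge[OF this X Y] and L = speed_L_le[OF bdd_below_lower_speed[OF W] X Y]
  have S: "speeds_bounded \<phi>max ?f a b X" "speeds_bounded \<phi>max ?f a b Y" if "a \<le> SL" "SR \<le> b" for a b
    using L R that unfolding defs
    by (auto intro: speeds_bounded_mono[OF speeds_bounded_phys_flux[OF bounds W X]]
        speeds_bounded_mono[OF speeds_bounded_phys_flux[OF bounds W Y]])
  obtain a b where ab: "num_flux kind ?f \<psi> \<kappa> M2 X Y = two_speed_flux ?f a b X Y"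
    "a \<le> SL" "SR \<le> b" "- s \<le> a" "a \<le> 0" "0 \<le> b" "b \<le> s"
  proof (cases kind)
    case LLF
    have "- s \<le> SL" "SR \<le> s" by (auto simp: defs)
    then have "num_flux kind ?f \<psi> \<kappa> M2 X Y = two_speed_flux ?f (- s) s X Y"
      using llf_flux_eq[OF defs(3) S[of "- s" s]] LLF by (simp add: num_flux_def defs)
    then show ?thesis using \<open>- s \<le> SL\<close> \<open>SR \<le> s\<close> by (intro that[of "- s" s]) (auto simp: defs)
  next
    case HLL
    then show ?thesis
      by (intro that[of "min SL 0" "max SR 0"]) (auto simp: num_flux_def hll_flux_eq defs)
  qed
  have "s * l \<le> c" using l by (auto simp: defs max_def)
  moreover have "b * l \<le> s * l" "- a * l \<le> s * l"
    using mult_right_mono[of b s l] mult_right_mono[of "- a" s l] ab l(1) by simp_all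
  ultimately have "l * b \<le> c" "l * - a \<le> c" by (simp_all add: mult.commute)
  with two_speed_flux_updates[OF ab(5,6) l(1) _ _ S[OF ab(2,3)]]
  show "c *\<^sub>R X - l *\<^sub>R num_flux kind ?f \<psi> \<kappa> M2 X Y \<in> state_set (c * \<phi>max)"
    "c *\<^sub>R Y + l *\<^sub>R num_flux kind ?f \<psi> \<kappa> M2 X Y \<in> state_set (c * \<phi>max)"
    unfolding ab(1) by blast+
qed

text \<open>The first and the last quadrature node carry the same weight, so each pays for one of the two
  interface fluxes.\<close>

lemma quadrature_update:
  fixes p :: "nat \<Rightarrow> ('n::finite) state"
  assumes G: "G \<in> {3, 4}" and u: "u = (\<Sum>m<G. lgl_weights G ! m *\<^sub>R p m)"
    and p: "\<And>m. m < G \<Longrightarrow> p m \<in> state_set \<phi>max" and c: "c = lgl_weights G ! 0"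
    and out: "c *\<^sub>R p (G - 1) - l *\<^sub>R F \<in> state_set (c * \<phi>max)"
    and inn: "c *\<^sub>R p 0 + l *\<^sub>R F' \<in> state_set (c * \<phi>max)"
  shows "u - l *\<^sub>R (F - F') \<in> state_set \<phi>max"
proof -
  let ?w = "\<lambda>m. lgl_weights G ! m"
  \<comment> \<open>As \<open>1 < G\<close>, the first and the last node differ. The type is general
    because the splitting is applied to states and to their bounds.\<close>
  have split: "(\<Sum>m<G. g m) = g 0 + ((\<Sum>m\<in>{1..<G - 1}. g m) + g (G - 1))"
    for g :: "nat \<Rightarrow> 'c::ab_group_add"
  proof -
    have "1 < G" using G by auto
    then have "{..<G} = insert 0 (insert (G - 1) {1..<G - 1})" by auto
    then have "(\<Sum>m<G. g m) = sum g (insert 0 (insert (G - 1) {1..<G - 1}))" by (rule arg_cong)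
    also have "\<dots> = g 0 + ((\<Sum>m\<in>{1..<G - 1}. g m) + g (G - 1))"
      using \<open>1 < G\<close> by (simp add: add_ac)
    finally show ?thesis .
  qed
  have "(\<Sum>m\<in>{1..<G - 1}. ?w m *\<^sub>R p m) \<in> state_set (\<Sum>m\<in>{1..<G - 1}. ?w m * \<phi>max)"
    using lgl_weights_pos[OF G] p by (intro state_set_sum state_set_scale) (auto simp: less_imp_le)
  from state_set_add[OF inn state_set_add[OF this out]]
  have "u - l *\<^sub>R (F - F') \<in> state_set (c * \<phi>max + ((\<Sum>m\<in>{1..<G - 1}. ?w m * \<phi>max) + c * \<phi>max))"
    unfolding u split lgl_weights_last[OF G] c[symmetric] by (simp add: algebra_simps)
  also have "c * \<phi>max + ((\<Sum>m\<in>{1..<G - 1}. ?w m * \<phi>max) + c * \<phi>max) = (\<Sum>m<G. ?w m * \<phi>max)"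
    unfolding split lgl_weights_last[OF G] c ..
  also have "\<dots> = \<phi>max"
    by (simp add: lgl_weights_sum[OF G] flip: sum_distrib_right)
  finally show ?thesis .
qed

theorem theorem3:
  fixes \<phi>max L \<Delta>x \<Delta>t lam \<delta> :: real
    and M :: nat
    and v :: "('n::{finite,linorder}) state \<Rightarrow> 'n state"
    and \<kappa> :: "'n state"
    and w w' \<psi> :: "real \<Rightarrow> real"
    and M2 :: "'n state \<Rightarrow> real"
    and W :: weno
    and kind :: flux_kind
    and bc :: boundary
    and U Unew UL UR F :: "int \<Rightarrow> 'n state"
  assumes "0 < \<phi>max" and "0 < L" and "0 < M" and "0 < \<Delta>t" and "0 < \<delta>"
    and "\<Delta>x = L / real M" and "lam = \<Delta>t / \<Delta>x"
    and model: "mclwr_model \<phi>max v \<kappa> w \<psi> M2 \<or> mlb_model \<phi>max v \<kappa> w \<psi> M2"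
    and hyperbolic: "hyperbolic_on (state_set \<phi>max) (phys_flux v)"
    and W_props: "w_properties \<phi>max v \<kappa> w w' \<psi>"
    and weno: "valid_weno W"
    and ghost_cells: "bc = Periodic \<longrightarrow> (\<forall>j. U (j + int M) = U j)"
    and limiter_data: "\<forall>j\<in>{0..<int M}. \<forall>i. \<delta> \<le> U j $ i"
    and left_states: "UL = state_L W \<Delta>x \<delta> \<phi>max M U"
    and right_states: "UR = state_R W \<Delta>x \<delta> \<phi>max M U"
    and fluxes: "F = interface_flux bc M (num_flux kind (phys_flux v) \<psi> \<kappa> M2) UL UR"
    and scheme: "\<forall>j\<in>{0..<int M}. Unew j = U j - lam *\<^sub>R (F j - F (j - 1))"
    and CFL: "max_speed bc M \<psi> \<kappa> M2 UL UR * lam \<le> cfl_factor kind * endpoint_weight W"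
    and initial: "\<forall>j\<in>{0..<int M}. U j \<in> state_set \<phi>max"
  shows "\<forall>j\<in>{0..<int M}. Unew j \<in> state_set \<phi>max"
proof
  fix j assume j: "j \<in> {0..<int M}"
  let ?G = "quad_size W" and ?c = "endpoint_weight W"
  let ?p = "\<lambda>k m. limited_state W \<Delta>x \<delta> \<phi>max U k (lgl_point \<Delta>x (quad_size W) k m)"
  have pos: "0 < \<Delta>x" "0 < lam" using assms(2-4,6,7) by simp_all
  have G: "?G \<in> {3, 4}" by (rule quad_size)
  then have G0: "0 < ?G" by auto
  have c: "?c = lgl_weights ?G ! 0" by (rule endpoint_weight_eq)
  have cpos: "0 \<le> ?c" using lgl_weights_pos[OF G G0] by (simp add: c)
  have p: "?p k m \<in> state_set \<phi>max" if "k \<in> {0..<int M}" "m < ?G" for k m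
    using that limiter_data initial
    by (intro limited_state_in_state_set[OF pos(1) weno \<open>0 < \<delta>\<close>]) (auto simp: lgl_points_eq[OF G])
  \<comment> \<open>Interface states are node states of the adjacent cells, at the last and the
    first node. Reduction modulo \<open>M\<close> keeps the cell index in range for every
    \<open>k\<close>.\<close>
  have UL: "UL k = ?p (k mod int M) (?G - 1)" and UR: "UR k = ?p ((k + 1) mod int M) 0" for k
    by (simp_all add: left_states right_states state_L_def state_R_def Let_def limited_state_def
        lgl_point_first[OF G] lgl_point_last[OF G] del: One_nat_def)
  have D: "UL k \<in> state_set \<phi>max" "UR k \<in> state_set \<phi>max" for k
    unfolding UL UR using G0 \<open>0 < M\<close> by (auto intro!: p)
  have bounds: "velocity_bounds \<phi>max v \<psi> \<kappa> M2"
    using model mclwr_velocity_bounds mlb_velocity_bounds[OF _ W_props \<open>0 < \<phi>max\<close>] by blast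
  have speed: "\<bar>speed_L \<psi> \<kappa> (UL k) (UR k)\<bar> * lam \<le> ?c" "\<bar>speed_R M2 (UL k) (UR k)\<bar> * lam \<le> ?c"
    if k: "k \<in> interfaces bc M" for k
  proof -
    have fin: "finite (\<Union>j\<in>interfaces bc M. {\<bar>speed_L \<psi> \<kappa> (UL j) (UR j)\<bar>, \<bar>speed_R M2 (UL j) (UR j)\<bar>})"
      by (auto simp: interfaces_def split: boundary.split)
    have "x * lam \<le> ?c" if "x \<in> {\<bar>speed_L \<psi> \<kappa> (UL k) (UR k)\<bar>, \<bar>speed_R M2 (UL k) (UR k)\<bar>}" for x
    proof -
      have "x \<le> max_speed bc M \<psi> \<kappa> M2 UL UR"
        unfolding max_speed_def using fin k that by (intro Max_ge) blast+
      then have "x * lam \<le> max_speed bc M \<psi> \<kappa> M2 UL UR * lam"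
        using pos by (intro mult_right_mono) auto
      also have "\<dots> \<le> cfl_factor kind * ?c" by (rule CFL)
      \<comment> \<open>The factor is 1 or 1/2, so for either flux the CFL condition bounds speed
        times \<open>lam\<close> by the endpoint weight.\<close>
      also have "\<dots> \<le> ?c" using cpos by (cases kind) (simp_all add: cfl_factor_def)
      finally show ?thesis .
    qed
    then show "\<bar>speed_L \<psi> \<kappa> (UL k) (UR k)\<bar> * lam \<le> ?c" "\<bar>speed_R M2 (UL k) (UR k)\<bar> * lam \<le> ?c"
      by blast+
  qed
  \<comment> \<open>At a zero-flux boundary \<open>F k\<close> is 0 and the claim is just the
    scaling of a state; elsewhere it is the estimate for the numerical flux.\<close>
  have flux: "?c *\<^sub>R UL k - lam *\<^sub>R F k \<in> state_set (?c * \<phi>max)"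
    "?c *\<^sub>R UR k + lam *\<^sub>R F k \<in> state_set (?c * \<phi>max)" for k
    unfolding fluxes interface_flux_def
    using num_flux_updates[OF bounds W_props D(1)[of k] D(2)[of k] less_imp_le[OF pos(2)] speed, of kind]
      state_set_scale[OF cpos D(1)[of k]] state_set_scale[OF cpos D(2)[of k]]
    by auto
  have "U j - lam *\<^sub>R (F j - F (j - 1)) \<in> state_set \<phi>max"
  proof (rule quadrature_update[OF G average_eq_limited_states[OF pos(1) weno] p[OF j] c])
    show "?c *\<^sub>R ?p j (?G - 1) - lam *\<^sub>R F j \<in> state_set (?c * \<phi>max)"
      using flux(1)[of j] j by (simp add: UL)
    \<comment> \<open>The first node of cell \<open>j\<close> is the right state of interface
      \<open>j - 1\<close>. For \<open>j = 0\<close> this is the interface numbered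
      \<open>-1\<close>, whose right state still belongs to cell 0.\<close>
    show "?c *\<^sub>R ?p j 0 + lam *\<^sub>R F (j - 1) \<in> state_set (?c * \<phi>max)"
      using flux(2)[of "j - 1"] j by (simp add: UR)
  qed
  then show "Unew j \<in> state_set \<phi>max" using scheme j by simp
qed

end
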